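(* If a dynamical system $(X,T)$ is transitive and has the shadowing property, then the collection of ergodic measures with full support (i.e. ergodic $\mu\in M_T(X)$ with $\operatorname{supp}(\mu)=X$) is residual in $M_T(X)$.
   Context: A dynamical system $(X,T)$ is a compact metric space $(X,d)$ with a continuous map $T\colon X\to X$ (not necessarily invertible). It is transitive if for any two nonempty open sets $U,V\subset X$ there is $n>0$ with $T^n(U)\cap V\neq\emptyset$. A sequence $(x_n)_{n=0}^\infty$ in $X$ is a $\delta$-pseudo-orbit if $d(T(x_n),x_{n+1})<\delta$ for all $n\ge 0$; it is $\varepsilon$-traced by $y\in X$ if $d(T^n(y),x_n)<\varepsilon$ for all $n\ge 0$. $(X,T)$ has the shadowing property if for every $\varepsilon>0$ there is $\delta>0$ such that every $\delta$-pseudo-orbit is $\varepsilon$-traced by some point of $X$. $M_T(X)$ is the space of $T$-invariant Borel probability measures on $X$ with the weak$^*$-topology. Residual means having complement of first category. *)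

theory Defs
  imports "HOL-Probability.Probability"
begin

text \<open>
  The phase space is a whole type of class \<^class>\<open>metric_space\<close>; compactness of the space and
  continuity of the map are bundled in \<open>dynamical_system\<close>. The other notions are meant to
  be used for maps satisfying it.
\<close>

definition dynamical_system :: "('a::metric_space \<Rightarrow> 'a) \<Rightarrow> bool" where
  "dynamical_system T \<longleftrightarrow> compact (UNIV :: 'a set) \<and> continuous_on UNIV T"

definition transitive_map :: "('a::metric_space \<Rightarrow> 'a) \<Rightarrow> bool" where
  "transitive_map T \<longleftrightarrow>
     (\<forall>U V. open U \<and> U \<noteq> {} \<and> open V \<and> V \<noteq> {} \<longrightarrow> (\<exists>n>0. (T ^^ n) ` U \<inter> V \<noteq> {}))"

definition pseudo_orbit :: "('a::metric_space \<Rightarrow> 'a) \<Rightarrow> real \<Rightarrow> (nat \<Rightarrow> 'a) \<Rightarrow> bool" where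
  "pseudo_orbit T \<delta> x \<longleftrightarrow> (\<forall>n. dist (T (x n)) (x (Suc n)) < \<delta>)"

definition traces :: "('a::metric_space \<Rightarrow> 'a) \<Rightarrow> real \<Rightarrow> 'a \<Rightarrow> (nat \<Rightarrow> 'a) \<Rightarrow> bool" where
  "traces T \<epsilon> y x \<longleftrightarrow> (\<forall>n. dist ((T ^^ n) y) (x n) < \<epsilon>)"

definition shadowing_property :: "('a::metric_space \<Rightarrow> 'a) \<Rightarrow> bool" where
  "shadowing_property T \<longleftrightarrow>
     (\<forall>\<epsilon>>0. \<exists>\<delta>>0. \<forall>x. pseudo_orbit T \<delta> x \<longrightarrow> (\<exists>y. traces T \<epsilon> y x))"

definition borel_probs :: "'a::metric_space measure set" where
  "borel_probs = {\<mu>. sets \<mu> = sets borel \<and> prob_space \<mu>}"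

definition invariant_measures :: "('a::metric_space \<Rightarrow> 'a) \<Rightarrow> 'a measure set" where
  "invariant_measures T =
     {\<mu> \<in> borel_probs. \<forall>A\<in>sets borel. measure \<mu> (T -` A) = measure \<mu> A}"

text \<open>
  The weak* topology on Borel probability measures is the coarsest one making
  \<open>\<mu> \<mapsto> \<integral> f d\<mu>\<close> continuous for every continuous real \<open>f\<close>. On a compact space every such
  \<open>f\<close> is bounded, hence integrable.
\<close>

definition weak_star_topology :: "'a::metric_space measure topology" where
  "weak_star_topology = topology_generated_by
     {{\<mu> \<in> borel_probs. integral\<^sup>L \<mu> f \<in> U} | (f :: 'a \<Rightarrow> real) U. continuous_on UNIV f \<and> open U}"

definition invariant_measure_space :: "('a::metric_space \<Rightarrow> 'a) \<Rightarrow> 'a measure topology" where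
  "invariant_measure_space T = subtopology weak_star_topology (invariant_measures T)"

definition ergodic_measure :: "('a::metric_space \<Rightarrow> 'a) \<Rightarrow> 'a measure \<Rightarrow> bool" where
  "ergodic_measure T \<mu> \<longleftrightarrow> \<mu> \<in> invariant_measures T \<and>
     (\<forall>A\<in>sets borel. T -` A = A \<longrightarrow> measure \<mu> A = 0 \<or> measure \<mu> A = 1)"

definition measure_support :: "'a::metric_space measure \<Rightarrow> 'a set" where
  "measure_support \<mu> = {x. \<forall>U. open U \<and> x \<in> U \<longrightarrow> measure \<mu> U > 0}"

definition nowhere_dense_in :: "'b topology \<Rightarrow> 'b set \<Rightarrow> bool" where
  "nowhere_dense_in Y N \<longleftrightarrow> N \<subseteq> topspace Y \<and> Y interior_of (Y closure_of N) = {}"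

definition first_category_in :: "'b topology \<Rightarrow> 'b set \<Rightarrow> bool" where
  "first_category_in Y A \<longleftrightarrow> (\<exists>\<N>. countable \<N> \<and> (\<forall>N\<in>\<N>. nowhere_dense_in Y N) \<and> A = \<Union>\<N>)"

definition residual_in :: "'b topology \<Rightarrow> 'b set \<Rightarrow> bool" where
  "residual_in Y R \<longleftrightarrow> R \<subseteq> topspace Y \<and> first_category_in Y (topspace Y - R)"

lemma topspace_weak_star_topology: "topspace weak_star_topology = borel_probs"
proof -
  have "borel_probs \<in> {{\<mu> \<in> borel_probs. integral\<^sup>L \<mu> f \<in> U} | (f :: 'a \<Rightarrow> real) U.
          continuous_on UNIV f \<and> open U}"
    by (rule CollectI, rule exI[of _ "\<lambda>_. 0"], rule exI[of _ UNIV]) auto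
  then show ?thesis
    unfolding weak_star_topology_def topology_generated_by_topspace by blast
qed

lemma topspace_invariant_measure_space:
  "topspace (invariant_measure_space T) = invariant_measures T"
  by (auto simp: invariant_measure_space_def topspace_weak_star_topology invariant_measures_def)

end

theory Submission
  imports Defs
begin

text \<open>
  A measure is ergodic as soon as, for every function \<open>f\<close> of a countable family that is dense in the
  mean, some Birkhoff averages \<open>A\<^sub>N f\<close> have arbitrarily small variance. For fixed \<open>N\<close> this variance is
  weak* continuous, so smallness is an open condition, and so is giving positive mass to a bump
  function. It remains to see that these conditions are dense. Given an invariant \<open>\<mu>\<close>, finitely many
  long orbit segments whose Birkhoff sums average to \<open>\<integral> g d\<mu>\<close> are joined, by transitivity, into a
  periodic pseudo-orbit through a prescribed point, the connecting pieces having bounded length. Along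
  a shadowing point, all averages of \<open>g\<close> over one period \<open>P\<close> are close to \<open>\<integral> g d\<mu>\<close>; hence any
  invariant measure \<open>\<nu>\<close> carried by its orbit closure is weak* close to \<open>\<mu>\<close>, and \<open>A\<^sub>P g\<close> has small
  variance under \<open>\<nu>\<close>. Such a \<open>\<nu>\<close> exists by the Krylov--Bogoliubov argument, where compactness comes
  from Helly's theorem on the real line through a coding of the space by ternary expansions.
\<close>

section \<open>Coding a compact metric space by real numbers\<close>

text \<open>One family serves two purposes: the bound \<open>K\<close>, uniform in \<open>x\<close>,
  will make decoding uniformly continuous, and the balls form a countable base that indexes bump
  functions and test functions.\<close>

definition fine_balls :: "(nat \<Rightarrow> 'a::metric_space) \<Rightarrow> (nat \<Rightarrow> real) \<Rightarrow> bool" where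
  "fine_balls c r \<longleftrightarrow>
     (\<forall>k. 0 < r k) \<and> (\<forall>e>0. \<exists>K. \<forall>x. \<exists>k<K. dist x (c k) < r k \<and> r k < e)"

text \<open>Take a finite cover by balls of radius \<open>1 / Suc n\<close> for every
  \<open>n\<close> and enumerate all the pairs of centre and radius in one sequence.\<close>

lemma compact_imp_fine_balls:
  assumes "compact (UNIV :: 'a::metric_space set)"
  obtains c :: "nat \<Rightarrow> 'a::metric_space" and r where "fine_balls c r"
proof -
  have "\<exists>F. finite F \<and> (UNIV :: 'a set) \<subseteq> (\<Union>x\<in>F. ball x (1 / real (Suc n)))" for n
  proof (rule compactE_image[OF assms, of UNIV "\<lambda>x. ball x (1 / real (Suc n))"])
    show "(UNIV :: 'a set) \<subseteq> (\<Union>x\<in>UNIV. ball x (1 / real (Suc n)))"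
    proof
      fix x :: 'a
      have "x \<in> ball x (1 / real (Suc n))" by simp
      then show "x \<in> (\<Union>x\<in>UNIV. ball x (1 / real (Suc n)))" by blast
    qed
  qed blast+
  then have "\<forall>n. \<exists>F. finite F \<and> (UNIV :: 'a set) \<subseteq> (\<Union>x\<in>F. ball x (1 / real (Suc n)))"
    by blast
  from choice[OF this] obtain F
    where F: "\<And>n. finite (F n)" "\<And>n. (UNIV :: 'a set) \<subseteq> (\<Union>x\<in>F n. ball x (1 / real (Suc n)))"
    by blast
  define S where "S = (\<Union>n. F n \<times> {1 / real (Suc n)})"
  have "F 0 \<noteq> {}" using F(2)[of 0] by auto
  then have "S \<noteq> {}" unfolding S_def by blast
  have "countable S" unfolding S_def by (intro countable_UN countableI_type countable_finite finite_cartesian_product F) simp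
  note S = \<open>countable S\<close> \<open>S \<noteq> {}\<close>
  define c r where "c k = fst (from_nat_into S k)" and "r k = snd (from_nat_into S k)" for k
  have "0 < r k" for k
    using from_nat_into[OF S(2), of k] by (auto simp: r_def S_def)
  moreover have "\<exists>K. \<forall>x. \<exists>k<K. dist x (c k) < r k \<and> r k < e" if "e > 0" for e
  proof -
    obtain n where n: "1 / real (Suc n) < e"
      using nat_approx_posE[OF \<open>e > 0\<close>] by blast
    \<comment> \<open>\<open>I\<close> holds the positions of the \<open>n\<close>-th cover in the
      enumeration; being finite, it yields the uniform bound \<open>K = Suc (Max I)\<close>.\<close>
    define I where "I = to_nat_on S ` (F n \<times> {1 / real (Suc n)})"
    have "finite I" using F by (simp add: I_def)
    have "\<exists>k<Suc (Max I). dist x (c k) < r k \<and> r k < e" for x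
    proof -
      obtain a where a: "a \<in> F n" "dist a x < 1 / real (Suc n)"
        using F(2)[of n] by (auto simp: subset_eq)
      define k where "k = to_nat_on S (a, 1 / real (Suc n))"
      have "(a, 1 / real (Suc n)) \<in> S" using a by (auto simp: S_def)
      then have "from_nat_into S k = (a, 1 / real (Suc n))"
        by (simp add: k_def S(1))
      moreover have "k \<in> I" using a by (auto simp: k_def I_def)
      ultimately show ?thesis
        using a n \<open>finite I\<close> by (auto simp: c_def r_def dist_commute less_Suc_eq_le intro!: exI[of _ k])
    qed
    then show ?thesis by blast
  qed
  ultimately show ?thesis using that[of c r] unfolding fine_balls_def by blast
qed

section \<open>Ternary codes of 0-1 sequences and their decoding\<close>

text \<open>Only the digits 0 and 1 are used in base 3, so the values form a Cantor set and distinct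
  sequences get distinct codes. Base 2 would identify 0111... with 1000....\<close>

definition ternary_code :: "(nat \<Rightarrow> bool) \<Rightarrow> real" where
  "ternary_code b = (\<Sum>k. of_bool (b k) * (1/3) ^ k)"

lemma summable_ternary: "summable (\<lambda>k. of_bool (b k) * (1/3) ^ k :: real)"
  by (rule summable_comparison_test'[OF summable_geometric[of "1/3"], of 0]) auto

lemma ternary_code_bounds: "0 \<le> ternary_code b" "ternary_code b \<le> 3/2"
proof -
  show "0 \<le> ternary_code b"
    unfolding ternary_code_def by (rule suminf_nonneg[OF summable_ternary]) auto
  have "ternary_code b \<le> (\<Sum>k. (1/3) ^ k)"
    unfolding ternary_code_def
    by (rule suminf_le[OF _ summable_ternary summable_geometric]) auto
  then show "ternary_code b \<le> 3/2" by (simp add: suminf_geometric)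
qed

lemma ternary_code_Suc: "ternary_code b = of_bool (b 0) + ternary_code (\<lambda>k. b (Suc k)) / 3"
proof -
  have "ternary_code b = (\<Sum>k. of_bool (b (Suc k)) * (1/3) ^ Suc k) + of_bool (b 0)"
    unfolding ternary_code_def using suminf_split_head[OF summable_ternary[of b]] by simp
  also have "(\<Sum>k. of_bool (b (Suc k)) * (1/3) ^ Suc k) = ternary_code (\<lambda>k. b (Suc k)) / 3"
    unfolding ternary_code_def using suminf_divide[OF summable_ternary[of "\<lambda>k. b (Suc k)"], of 3]
    by simp
  finally show ?thesis by simp
qed

text \<open>The digits after the first contribute between 0 and 1/2, so a difference in digit 0
  leaves a gap of at least 1/2. Peeling off equal leading digits scales the gap by 1/3. The index
  \<open>k\<close> may be any place of disagreement; an earlier one only widens the gap.\<close>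

lemma ternary_code_separates:
  assumes "b k \<noteq> b' k"
  shows "(1/3) ^ k / 2 \<le> \<bar>ternary_code b - ternary_code b'\<bar>"
  using assms
proof (induction k arbitrary: b b')
  case 0
  then show ?case
    using ternary_code_bounds[of "\<lambda>k. b (Suc k)"] ternary_code_bounds[of "\<lambda>k. b' (Suc k)"]
    by (cases "b 0") (auto simp: ternary_code_Suc[of b] ternary_code_Suc[of b'])
next
  case (Suc k)
  show ?case
  proof (cases "b 0 = b' 0")
    case True
    have "(1/3) ^ k / 2 \<le> \<bar>ternary_code (\<lambda>k. b (Suc k)) - ternary_code (\<lambda>k. b' (Suc k))\<bar>"
      using Suc.IH[of "\<lambda>k. b (Suc k)" "\<lambda>k. b' (Suc k)"] Suc.prems by simp
    then show ?thesis
      using True unfolding ternary_code_Suc[of b] ternary_code_Suc[of b']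
      by (simp add: abs_if split: if_splits)
  next
    case False
    have "(1/3) ^ Suc k \<le> (1::real)" by (rule power_le_one) auto
    then show ?thesis
      using False ternary_code_bounds[of "\<lambda>k. b (Suc k)"] ternary_code_bounds[of "\<lambda>k. b' (Suc k)"]
      by (cases "b 0") (auto simp: ternary_code_Suc[of b] ternary_code_Suc[of b'])
  qed
qed

text \<open>A point is coded by the list of balls of the fine family that contain it. Points with
  close codes agree on the first \<open>K\<close> memberships and therefore share a small ball. The
  coding \<open>\<kappa>\<close> may be discontinuous; only its inverse has to be
  controlled.\<close>

lemma compact_imp_real_coding:
  assumes "compact (UNIV :: 'a::metric_space set)"
  obtains \<kappa> :: "'a::metric_space \<Rightarrow> real" where "range \<kappa> \<subseteq> {0..3/2}"
    "\<And>e. e > 0 \<Longrightarrow> \<exists>d>0. \<forall>x y. \<bar>\<kappa> x - \<kappa> y\<bar> < d \<longrightarrow> dist x y < e"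
proof -
  obtain c :: "nat \<Rightarrow> 'a" and r where "fine_balls c r"
    using compact_imp_fine_balls[OF assms] by blast
  then have fine: "\<exists>K. \<forall>x. \<exists>k<K. dist x (c k) < r k \<and> r k < e" if "e > 0" for e
    using that by (auto simp: fine_balls_def)
  define b where "b x k \<longleftrightarrow> dist x (c k) < r k" for x k
  show thesis
  proof
    show "range (\<lambda>x. ternary_code (b x)) \<subseteq> {0..3/2}"
      using ternary_code_bounds by auto
    fix e :: real assume "e > 0"
    then obtain K where K: "\<And>x. \<exists>k<K. dist x (c k) < r k \<and> r k < e/2"
      using fine[of "e/2"] by auto
    have "dist x y < e" if "\<bar>ternary_code (b x) - ternary_code (b y)\<bar> < (1/3) ^ K / 2" for x y
    proof -
      obtain k where k: "k < K" "dist x (c k) < r k" "r k < e/2" using K by blast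
      \<comment> \<open>A difference in a digit below \<open>K\<close> would separate the codes by
        at least \<open>(1/3) ^ K / 2\<close>.\<close>
      have "b x k = b y k"
      proof (rule ccontr)
        assume "b x k \<noteq> b y k"
        from ternary_code_separates[of "b x" k "b y", OF this] that
        have "(1/3) ^ k < (1/3::real) ^ K" by linarith
        moreover have "(1/3::real) ^ K \<le> (1/3) ^ k" using k by (intro power_decreasing) auto
        ultimately show False by simp
      qed
      then have "dist y (c k) < r k" using k by (simp add: b_def)
      then show ?thesis using k dist_triangle2[of x y "c k"] by simp
    qed
    then show "\<exists>d>0. \<forall>x y. \<bar>ternary_code (b x) - ternary_code (b y)\<bar> < d \<longrightarrow> dist x y < e"
      by (intro exI[of _ "(1/3) ^ K / 2"]) auto
  qed
qed

text \<open>The inverse of the coding is uniformly continuous, hence extends to the closure of the set of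
  codes.\<close>

lemma compact_imp_continuous_image_of_reals:
  assumes "compact (UNIV :: 'a::metric_space set)"
  obtains C :: "real set" and \<pi> :: "real \<Rightarrow> 'a::metric_space" and \<kappa> :: "'a \<Rightarrow> real"
  where "closed C" "C \<subseteq> {0..3/2}" "continuous_on C \<pi>" "\<And>x. \<kappa> x \<in> C" "\<And>x. \<pi> (\<kappa> x) = x"
proof -
  obtain \<kappa> :: "'a \<Rightarrow> real" where range: "range \<kappa> \<subseteq> {0..3/2}"
    and uc: "\<And>e. e > 0 \<Longrightarrow> \<exists>d>0. \<forall>x y. \<bar>\<kappa> x - \<kappa> y\<bar> < d \<longrightarrow> dist x y < e"
    using compact_imp_real_coding[OF assms] by blast
  define C where "C = closure (range \<kappa>)"
  \<comment> \<open>\<open>p\<close> is the limit of the decoded points as the codes tend to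
    \<open>t\<close>: compactness gives a cluster point, and uniform continuity of decoding makes it
    the limit.\<close>
  have "\<exists>p. \<forall>e>0. \<exists>d>0. \<forall>x. \<bar>\<kappa> x - t\<bar> < d \<longrightarrow> dist x p < e" if "t \<in> C" for t
  proof -
    obtain s where s: "\<And>n. s n \<in> range \<kappa>" "s \<longlonglongrightarrow> t"
      using \<open>t \<in> C\<close> unfolding C_def closure_sequential by blast
    have "\<forall>n. \<exists>x. s n = \<kappa> x" using s(1) by blast
    from choice[OF this] obtain x where x: "\<And>n. s n = \<kappa> (x n)" by blast
    obtain p q where q: "strict_mono q" "(x \<circ> q) \<longlonglongrightarrow> p"
      using compact_def[of "UNIV :: 'a set"] assms by (metis UNIV_I)
    have sq: "(\<lambda>n. \<kappa> (x (q n))) \<longlonglongrightarrow> t"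
      using LIMSEQ_subseq_LIMSEQ[OF s(2) q(1)] by (simp add: o_def x)
    show ?thesis
    proof (intro exI[of _ p] allI impI)
      fix e :: real assume "e > 0"
      then obtain d where d: "d > 0" "\<And>x y. \<bar>\<kappa> x - \<kappa> y\<bar> < d \<Longrightarrow> dist x y < e/2"
        using uc[of "e/2"] by auto
      have "dist z p < e" if z: "\<bar>\<kappa> z - t\<bar> < d/2" for z
      proof -
        have "\<forall>\<^sub>F n in sequentially. dist (\<kappa> (x (q n))) t < d/2 \<and> dist ((x \<circ> q) n) p < e/2"
          using tendstoD[OF sq, of "d/2"] tendstoD[OF q(2), of "e/2"] d(1) \<open>e > 0\<close>
          by (intro eventually_conj) auto
        then obtain n where n: "\<bar>\<kappa> (x (q n)) - t\<bar> < d/2" "dist (x (q n)) p < e/2"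
          by (auto simp: dist_real_def dest!: eventually_happens)
        then have "dist z (x (q n)) < e/2" using z by (intro d(2)) linarith
        then show ?thesis using n(2) dist_triangle[of z p "x (q n)"] by linarith
      qed
      then show "\<exists>d>0. \<forall>x. \<bar>\<kappa> x - t\<bar> < d \<longrightarrow> dist x p < e"
        using d(1) by (intro exI[of _ "d/2"]) auto
    qed
  qed
  then have "\<forall>t\<in>C. \<exists>p. \<forall>e>0. \<exists>d>0. \<forall>x. \<bar>\<kappa> x - t\<bar> < d \<longrightarrow> dist x p < e" by blast
  from bchoice[OF this] obtain \<pi>
    where \<pi>: "\<And>t e. t \<in> C \<Longrightarrow> e > 0 \<Longrightarrow> \<exists>d>0. \<forall>x. \<bar>\<kappa> x - t\<bar> < d \<longrightarrow> dist x (\<pi> t) < e"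
    by blast
  show thesis
  proof
    show "closed C" by (simp add: C_def)
    show "C \<subseteq> {0..3/2}" unfolding C_def by (rule closure_minimal[OF range]) simp
    show \<kappa>: "\<kappa> x \<in> C" for x using closure_subset[of "range \<kappa>"] by (auto simp: C_def)
    show "\<pi> (\<kappa> x) = x" for x
    proof (rule ccontr)
      \<comment> \<open>The code of \<open>x\<close> is at distance 0 from itself, so
        \<open>x\<close> would be closer to \<open>\<pi> (\<kappa> x)\<close> than it is.\<close>
      assume "\<pi> (\<kappa> x) \<noteq> x"
      then obtain d where "d > 0" "\<And>z. \<bar>\<kappa> z - \<kappa> x\<bar> < d \<Longrightarrow> dist z (\<pi> (\<kappa> x)) < dist x (\<pi> (\<kappa> x))"
        using \<pi>[OF \<kappa>, of "dist x (\<pi> (\<kappa> x))" x] by auto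
      from this(2)[of x] \<open>d > 0\<close> show False by simp
    qed
    show "continuous_on C \<pi>"
      unfolding continuous_on_iff
    proof (intro ballI allI impI)
      fix t e :: real assume "t \<in> C" "e > 0"
      then obtain d where d: "d > 0" "\<And>x. \<bar>\<kappa> x - t\<bar> < d \<Longrightarrow> dist x (\<pi> t) < e/2"
        using \<pi>[of t "e/2"] by auto
      have "dist (\<pi> t') (\<pi> t) < e" if t': "t' \<in> C" "dist t' t < d/2" for t'
      proof -
        obtain d' where d': "d' > 0" "\<And>x. \<bar>\<kappa> x - t'\<bar> < d' \<Longrightarrow> dist x (\<pi> t') < e/2"
          using \<pi>[of t' "e/2"] t' \<open>e > 0\<close> by auto
        \<comment> \<open>A genuine code near both \<open>t'\<close> and \<open>t\<close> belongs to
          a point \<open>x\<close> that is near both \<open>\<pi> t'\<close> and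
          \<open>\<pi> t\<close>.\<close>
        have "0 < min d' (d/2)" using d(1) d'(1) by simp
        then obtain x where x: "dist (\<kappa> x) t' < min d' (d/2)"
          using t'(1) unfolding C_def closure_approachable by blast
        have "dist x (\<pi> t') < e/2" using x by (intro d') (auto simp: dist_real_def)
        moreover have "dist x (\<pi> t) < e/2"
          using x t'(2) unfolding dist_real_def by (intro d) linarith
        ultimately show ?thesis using dist_triangle3[of "\<pi> t'" "\<pi> t" x] by linarith
      qed
      then show "\<exists>d>0. \<forall>t'\<in>C. dist t' t < d \<longrightarrow> dist (\<pi> t') (\<pi> t) < e"
        using d(1) by (intro exI[of _ "d/2"]) auto
    qed
  qed
qed

section \<open>Weak limits of empirical measures\<close>

lemma borel_probs_prob_space: "\<mu> \<in> borel_probs \<Longrightarrow> prob_space \<mu>"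
  by (simp add: borel_probs_def)

lemma borel_probs_sets: "\<mu> \<in> borel_probs \<Longrightarrow> sets \<mu> = sets borel"
  by (simp add: borel_probs_def)

lemma compact_imp_continuous_bounded:
  fixes f :: "'a::metric_space \<Rightarrow> real"
  assumes "compact (UNIV :: 'a set)" "continuous_on UNIV f"
  obtains B where "0 < B" "\<And>x. \<bar>f x\<bar> \<le> B"
proof -
  have "bounded (range f)"
    using compact_imp_bounded[OF compact_continuous_image[OF assms(2,1)]] .
  then show ?thesis using that unfolding bounded_pos by (auto simp: real_norm_def)
qed

lemma borel_probs_integrable:
  fixes f :: "'a::metric_space \<Rightarrow> real"
  assumes "\<mu> \<in> borel_probs" "f \<in> borel_measurable borel" "\<And>x. \<bar>f x\<bar> \<le> B"
  shows "integrable \<mu> f"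
proof -
  interpret prob_space \<mu> using borel_probs_prob_space[OF assms(1)] .
  have "f \<in> borel_measurable \<mu>"
    using assms(2) measurable_cong_sets[OF borel_probs_sets[OF assms(1)] refl] by blast
  then show ?thesis using assms(3) by (intro integrable_const_bound[of _ B]) auto
qed

lemma borel_probs_integrable_continuous:
  fixes f :: "'a::metric_space \<Rightarrow> real"
  assumes "compact (UNIV :: 'a set)" "\<mu> \<in> borel_probs" "continuous_on UNIV f"
  shows "integrable \<mu> f"
proof -
  obtain B where "\<And>x. \<bar>f x\<bar> \<le> B" using compact_imp_continuous_bounded[OF assms(1,3)] by blast
  then show ?thesis
    by (intro borel_probs_integrable[OF assms(2)] borel_measurable_continuous_onI[OF assms(3)])
qed

text \<open>Indicators of closed sets are pointwise limits of continuous functions of the distance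
  to the set, so the measures agree on the closed sets, an intersection-stable generator. The empty
  set is treated apart because \<open>infdist\<close> to it is 0 by convention.\<close>

lemma borel_probs_eqI:
  fixes \<mu> \<nu> :: "'a::metric_space measure"
  assumes \<mu>: "\<mu> \<in> borel_probs" and \<nu>: "\<nu> \<in> borel_probs"
    and eq: "\<And>f. continuous_on UNIV f \<Longrightarrow> (\<And>x. \<bar>f x\<bar> \<le> 1) \<Longrightarrow> integral\<^sup>L \<mu> f = integral\<^sup>L \<nu> (f :: 'a \<Rightarrow> real)"
  shows "\<mu> = \<nu>"
proof -
  interpret M: prob_space \<mu> using borel_probs_prob_space[OF \<mu>] .
  interpret N: prob_space \<nu> using borel_probs_prob_space[OF \<nu>] .
  have closed: "measure \<mu> F = measure \<nu> F" if F: "closed F" "F \<noteq> {}" for F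
  proof -
    define f where "f n x = max 0 (1 - real n * infdist x F)" for n x
    have cont: "continuous_on UNIV (f n)" for n
      unfolding f_def by (intro continuous_intros)
    have bd: "\<bar>f n x\<bar> \<le> 1" for n x
      using infdist_nonneg[of x F] by (auto simp: f_def)
    have lim: "(\<lambda>n. f n x) \<longlonglongrightarrow> indicator F x" for x
    proof (cases "x \<in> F")
      case True then show ?thesis by (simp add: f_def)
    next
      case False
      then have pos: "infdist x F > 0" using F
        by (metis infdist_nonneg in_closed_iff_infdist_zero less_eq_real_def)
      obtain m where "1 < real m * infdist x F" using reals_Archimedean3[OF pos] by blast
      then have "\<forall>\<^sub>F n in sequentially. f n x = 0"
        unfolding eventually_sequentially
      proof (intro exI[of _ m] allI impI)
        fix n assume "m \<le> n"
        then have "real m * infdist x F \<le> real n * infdist x F"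
          using pos by (intro mult_right_mono) auto
        then show "f n x = 0" using \<open>1 < real m * infdist x F\<close> by (simp add: f_def)
      qed
      then show ?thesis using False by (simp add: tendsto_eventually)
    qed
    have conv: "(\<lambda>n. integral\<^sup>L \<rho> (f n)) \<longlonglongrightarrow> measure \<rho> F" if "\<rho> \<in> borel_probs" for \<rho>
    proof -
      interpret R: prob_space \<rho> using borel_probs_prob_space[OF that] .
      have meas: "g \<in> borel_measurable \<rho>" if "g \<in> borel_measurable borel" for g :: "'a \<Rightarrow> real"
        using that measurable_cong_sets[OF borel_probs_sets[OF \<open>\<rho> \<in> borel_probs\<close>] refl] by blast
      have "(\<lambda>n. integral\<^sup>L \<rho> (f n)) \<longlonglongrightarrow> integral\<^sup>L \<rho> (indicator F)"
      proof (rule integral_dominated_convergence[where w = "\<lambda>_. 1"])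
        show "(indicator F :: 'a \<Rightarrow> real) \<in> borel_measurable \<rho>"
          using F(1) by (intro meas) simp
        show "f n \<in> borel_measurable \<rho>" for n
          by (intro meas borel_measurable_continuous_onI cont)
      qed (use bd lim in auto)
      moreover have "F \<in> sets \<rho>" using F(1) borel_probs_sets[OF that] by simp
      ultimately show ?thesis by simp
    qed
    show ?thesis
      using LIMSEQ_unique[OF conv[OF \<mu>]] conv[OF \<nu>] eq[OF cont bd] by simp
  qed
  show ?thesis
  proof (rule measure_eqI_generator_eq[where E = "Collect closed" and \<Omega> = UNIV and A = "\<lambda>_. UNIV"])
    show "Int_stable (Collect closed :: 'a set set)" by (auto simp: Int_stable_def)
    show "sets \<mu> = sigma_sets UNIV (Collect closed)" "sets \<nu> = sigma_sets UNIV (Collect closed)"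
      using borel_probs_sets[OF \<mu>] borel_probs_sets[OF \<nu>]
      by (simp_all add: borel_eq_closed[where 'a='a])
    fix F :: "'a set" assume "F \<in> Collect closed"
    then show "emeasure \<mu> F = emeasure \<nu> F"
      using closed[of F] by (cases "F = {}") (auto simp: M.emeasure_eq_measure N.emeasure_eq_measure)
  next
    show "emeasure \<mu> UNIV \<noteq> \<infinity>" by (simp add: M.emeasure_eq_measure)
  qed auto
qed

text \<open>The empirical measures are moved to the real line by \<open>\<kappa>\<close>, where
  tightness gives a weakly convergent subsequence. The limit \<open>L\<close> lives on the closed
  set \<open>C\<close> of codes and is brought back by \<open>\<pi>\<close>.\<close>

lemma ex_weak_limit_of_averages:
  fixes x :: "nat \<Rightarrow> 'a::metric_space"
  assumes cpt: "compact (UNIV :: 'a set)"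
  obtains \<nu> r where "\<nu> \<in> borel_probs" "strict_mono (r :: nat \<Rightarrow> nat)"
    "\<And>h. continuous_on UNIV h \<Longrightarrow>
       (\<lambda>n. (\<Sum>i\<le>r n. h (x i)) / real (Suc (r n))) \<longlonglongrightarrow> integral\<^sup>L \<nu> (h :: 'a \<Rightarrow> real)"
proof -
  obtain C \<pi> \<kappa> where C: "closed C" "C \<subseteq> {0..3/2}" and \<pi>: "continuous_on C (\<pi> :: real \<Rightarrow> 'a)"
    and \<kappa>: "\<And>x. \<kappa> x \<in> C" "\<And>x. \<pi> (\<kappa> x) = x"
    using compact_imp_continuous_image_of_reals[OF cpt] by blast
  define M where "M n = distr (uniform_count_measure {..n}) borel (\<lambda>i. \<kappa> (x i))" for n
  have real_M: "real_distribution (M n)" for n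
    unfolding M_def
    by (intro prob_space.real_distribution_distr prob_space_uniform_count_measure) auto
  have int_M: "integral\<^sup>L (M n) f = (\<Sum>i\<le>n. f (\<kappa> (x i))) / real (Suc n)"
    if "f \<in> borel_measurable borel" for f :: "real \<Rightarrow> real" and n
    unfolding M_def using that
    by (subst integral_distr) (auto simp: integral_uniform_count_measure)
  \<comment> \<open>All codes lie in \<open>{0..3/2}\<close>, so this one interval carries every
    \<open>M n\<close> and tightness follows.\<close>
  have measure_M: "measure (M n) {-1<..2} = 1" for n
  proof -
    interpret real_distribution "M n" by (rule real_M)
    have "measure (M n) {-1<..2} = integral\<^sup>L (M n) (indicator {-1<..2})" by simp
    also have "\<dots> = (\<Sum>i\<le>n. indicator {-1<..2} (\<kappa> (x i))) / real (Suc n)"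
      by (rule int_M) simp
    also have "(\<Sum>i\<le>n. indicator {-1<..2} (\<kappa> (x i)) :: real) = (\<Sum>i\<le>n. 1)"
    proof (rule sum.cong[OF refl])
      fix i
      have "0 \<le> \<kappa> (x i)" "\<kappa> (x i) \<le> 3/2" using \<kappa>(1)[of "x i"] C(2) by auto
      then show "indicator {-1<..2} (\<kappa> (x i)) = (1::real)" by simp
    qed
    finally show ?thesis by simp
  qed
  have "tight M"
    unfolding tight_def
  proof (intro conjI allI impI real_M)
    fix e :: real assume "e > 0"
    then show "\<exists>a b. a < b \<and> (\<forall>n. measure (M n) {a<..b} > 1 - e)"
      using measure_M by (intro exI[of _ "-1"] exI[of _ "2::real"]) auto
  qed
  then obtain r L where r: "strict_mono (r :: nat \<Rightarrow> nat)" and L: "real_distribution L"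
    and "weak_conv_m (M \<circ> id \<circ> r) L"
    using tight_imp_convergent_subsubsequence[of M id] strict_mono_id by blast
  then have conv: "weak_conv_m (\<lambda>n. M (r n)) L" by (simp add: o_def)
  interpret L: real_distribution L by (rule L)
  have lim: "(\<lambda>n. (\<Sum>i\<le>r n. f (\<kappa> (x i))) / real (Suc (r n))) \<longlonglongrightarrow> integral\<^sup>L L f"
    if f: "continuous_on UNIV f" "\<And>t. \<bar>f t\<bar> \<le> B" for f :: "real \<Rightarrow> real" and B
  proof -
    have "(\<lambda>n. integral\<^sup>L (M (r n)) f) \<longlonglongrightarrow> integral\<^sup>L L f"
      using f by (intro weak_conv_imp_integral_bdd_continuous_conv[OF real_M L conv, of _ B])
        (auto simp: continuous_on_eq_continuous_at)
    then show ?thesis using int_M borel_measurable_continuous_onI[OF f(1)] by simp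
  qed
  have "C \<noteq> {}" using \<kappa>(1) by blast
  have AE_C: "AE t in L. t \<in> C"
  proof -
    \<comment> \<open>This bounded continuous function vanishes exactly on \<open>C\<close>. It is 0
      at every code, so its integral against the weak limit is 0.\<close>
    define f where "f t = min 1 (infdist t C)" for t
    have f: "continuous_on UNIV f" "\<And>t. \<bar>f t\<bar> \<le> 1"
      using infdist_nonneg[of _ C] by (auto simp: f_def intro!: continuous_intros)
    have "f (\<kappa> y) = 0" for y using \<kappa>(1) by (simp add: f_def)
    then have "integral\<^sup>L L f = 0"
      using lim[OF f] by (simp add: LIMSEQ_const_iff)
    moreover have [measurable]: "f \<in> borel_measurable borel"
      by (rule borel_measurable_continuous_onI[OF f(1)])
    then have "integrable L f" using f(2) by (intro L.integrable_const_bound[of _ 1]) auto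
    moreover have "AE t in L. 0 \<le> f t" using infdist_nonneg[of _ C] by (simp add: f_def)
    ultimately have "AE t in L. f t = 0" using integral_nonneg_eq_0_iff_AE[of L f] by simp
    then show ?thesis
      using C(1) \<open>C \<noteq> {}\<close> by (auto simp: f_def in_closed_iff_infdist_zero min_def split: if_splits)
  qed
  \<comment> \<open>The constant value off \<open>C\<close>, an \<open>L\<close>-null set, only
    makes \<open>\<pi>\<close> a total Borel map.\<close>
  define p where "p t = (if t \<in> C then \<pi> t else \<pi> (\<kappa> (x 0)))" for t
  have p [measurable]: "p \<in> borel_measurable borel"
    unfolding p_def by (rule borel_measurable_continuous_on_if) (use C \<pi> in auto)
  define \<nu> where "\<nu> = distr L borel p"
  have "\<nu> \<in> borel_probs"
    unfolding borel_probs_def \<nu>_def by (auto intro!: L.prob_space_distr)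
  moreover have "(\<lambda>n. (\<Sum>i\<le>r n. h (x i)) / real (Suc (r n))) \<longlonglongrightarrow> integral\<^sup>L \<nu> h"
    if h: "continuous_on UNIV h" for h :: "'a \<Rightarrow> real"
  proof -
    obtain B where B: "0 < B" "\<And>x. \<bar>h x\<bar> \<le> B" using compact_imp_continuous_bounded[OF cpt h] by blast
    have "continuous_on C (\<lambda>t. h (\<pi> t))"
      using continuous_on_compose2[OF h \<pi>] by simp
    \<comment> \<open>Weak convergence needs a bounded continuous function on the whole line, while
      \<open>h\<close> composed with \<open>\<pi>\<close> is controlled only on \<open>C\<close>;
      Tietze's theorem extends it with the same bound.\<close>
    then obtain g where g: "continuous_on UNIV g" "\<And>t. t \<in> C \<Longrightarrow> g t = h (\<pi> t)" "\<And>t. norm (g t) \<le> B"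
      using Tietze[of C "\<lambda>t. h (\<pi> t)" UNIV B] C(1) B by auto
    have [measurable]: "h \<in> borel_measurable borel" "g \<in> borel_measurable borel"
      using h g(1) by (auto intro: borel_measurable_continuous_onI)
    have "integral\<^sup>L \<nu> h = (\<integral>t. h (p t) \<partial>L)"
      unfolding \<nu>_def by (subst integral_distr) auto
    also have "\<dots> = integral\<^sup>L L g"
    proof (rule integral_cong_AE)
      show "(\<lambda>t. h (p t)) \<in> borel_measurable L" "g \<in> borel_measurable L" by measurable
      show "AE t in L. h (p t) = g t" using AE_C by eventually_elim (simp add: p_def g(2))
    qed
    finally show ?thesis using lim[OF g(1), of B] g \<kappa> by simp
  qed
  ultimately show ?thesis using that r by blast
qed

section \<open>Invariant measures\<close>

lemma invariant_measures_borel_probs: "\<mu> \<in> invariant_measures T \<Longrightarrow> \<mu> \<in> borel_probs"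
  by (simp add: invariant_measures_def)

lemma distr_eq_imp_invariant:
  assumes "\<mu> \<in> borel_probs" "T \<in> borel_measurable borel" "distr \<mu> borel T = \<mu>"
  shows "\<mu> \<in> invariant_measures T"
proof -
  have T: "T \<in> measurable \<mu> borel"
    using assms(2) measurable_cong_sets[OF borel_probs_sets[OF assms(1)] refl] by blast
  have "space \<mu> = UNIV"
    using sets_eq_imp_space_eq[OF borel_probs_sets[OF assms(1)]] by simp
  then have "measure \<mu> (T -` A) = measure \<mu> A" if "A \<in> sets borel" for A
    using measure_distr[OF T that] assms(3) by simp
  then show ?thesis using assms(1) by (simp add: invariant_measures_def)
qed

lemma invariant_imp_distr_eq:
  assumes "\<mu> \<in> invariant_measures T" "T \<in> borel_measurable borel"
  shows "distr \<mu> borel T = \<mu>"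
proof (rule measure_eqI)
  note \<mu> = invariant_measures_borel_probs[OF assms(1)]
  interpret prob_space \<mu> using borel_probs_prob_space[OF \<mu>] .
  have T: "T \<in> measurable \<mu> borel"
    using assms(2) measurable_cong_sets[OF borel_probs_sets[OF \<mu>] refl] by blast
  have "space \<mu> = UNIV"
    using sets_eq_imp_space_eq[OF borel_probs_sets[OF \<mu>]] by simp
  moreover fix A assume "A \<in> sets (distr \<mu> borel T)"
  ultimately show "emeasure (distr \<mu> borel T) A = emeasure \<mu> A"
    using assms(1) by (auto simp: emeasure_distr[OF T] emeasure_eq_measure invariant_measures_def)
qed (use borel_probs_sets[OF invariant_measures_borel_probs[OF assms(1)]] in simp)

lemma invariant_integral_comp:
  fixes f :: "'a::metric_space \<Rightarrow> real"
  assumes "\<mu> \<in> invariant_measures T" "T \<in> borel_measurable borel" "f \<in> borel_measurable borel"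
  shows "(\<integral>x. f (T x) \<partial>\<mu>) = integral\<^sup>L \<mu> f"
proof -
  have "T \<in> measurable \<mu> borel"
    using assms(2) measurable_cong_sets[OF borel_probs_sets[OF invariant_measures_borel_probs[OF assms(1)]] refl]
    by blast
  from integral_distr[OF this assms(3)] show ?thesis
    by (simp add: invariant_imp_distr_eq[OF assms(1,2)])
qed

lemma continuous_on_funpow:
  fixes T :: "'a::topological_space \<Rightarrow> 'a"
  shows "continuous_on UNIV T \<Longrightarrow> continuous_on UNIV (T ^^ n)"
  by (induction n) (auto intro: continuous_on_compose2[of UNIV T UNIV] simp: id_def o_def)

lemma invariant_integral_funpow:
  fixes f :: "'a::metric_space \<Rightarrow> real"
  assumes "\<mu> \<in> invariant_measures T" "continuous_on UNIV T" "f \<in> borel_measurable borel"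
  shows "(\<integral>x. f ((T ^^ n) x) \<partial>\<mu>) = integral\<^sup>L \<mu> f"
proof (induction n)
  case (Suc n)
  have [measurable]: "T ^^ n \<in> borel_measurable borel" "f \<in> borel_measurable borel"
    by (intro borel_measurable_continuous_onI continuous_on_funpow assms)+
  have "(\<integral>x. f ((T ^^ n) (T x)) \<partial>\<mu>) = (\<integral>x. f ((T ^^ n) x) \<partial>\<mu>)"
    by (rule invariant_integral_comp[OF assms(1) borel_measurable_continuous_onI[OF assms(2)]]) measurable
  then show ?case using Suc by (simp only: funpow_Suc_right o_apply)
qed simp

section \<open>Birkhoff sums and invariant measures carried by an orbit\<close>

definition birkhoff_sum :: "('a \<Rightarrow> 'a) \<Rightarrow> nat \<Rightarrow> ('a \<Rightarrow> real) \<Rightarrow> 'a \<Rightarrow> real" where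
  "birkhoff_sum T n f x = (\<Sum>i<n. f ((T ^^ i) x))"

lemma continuous_on_birkhoff_sum:
  fixes T :: "'a::topological_space \<Rightarrow> 'a"
  assumes "continuous_on UNIV T" "continuous_on UNIV f"
  shows "continuous_on UNIV (birkhoff_sum T n f)"
  unfolding birkhoff_sum_def
  by (intro continuous_on_sum continuous_on_compose2[OF assms(2) continuous_on_funpow[OF assms(1)]]) simp

lemma invariant_integral_birkhoff_sum:
  assumes "compact (UNIV :: 'a::metric_space set)" "continuous_on UNIV T"
    and "\<mu> \<in> invariant_measures T" "continuous_on UNIV (f :: 'a \<Rightarrow> real)"
  shows "integral\<^sup>L \<mu> (birkhoff_sum T n f) = n * integral\<^sup>L \<mu> f"
proof -
  have "continuous_on UNIV (\<lambda>x. f ((T ^^ i) x))" for i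
    by (rule continuous_on_compose2[OF assms(4) continuous_on_funpow[OF assms(2)]]) simp
  then have "integrable \<mu> (\<lambda>x. f ((T ^^ i) x))" for i
    using borel_probs_integrable_continuous[OF assms(1) invariant_measures_borel_probs[OF assms(3)]]
    by blast
  then show ?thesis
    unfolding birkhoff_sum_def
    using invariant_integral_funpow[OF assms(3,2) borel_measurable_continuous_onI[OF assms(4)]]
    by (subst Bochner_Integration.integral_sum) simp_all
qed

text \<open>Krylov--Bogoliubov: a weak limit of the empirical measures along the orbit of
  \<open>y\<close> is invariant. That it is carried by the orbit closure is expressed through
  integrals: an upper bound for a continuous function along the orbit bounds its integral. Lower
  bounds come from \<open>-h\<close>.\<close>

lemma ex_invariant_measure_on_orbit:
  fixes T :: "'a::metric_space \<Rightarrow> 'a"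
  assumes cpt: "compact (UNIV :: 'a set)" and cont: "continuous_on UNIV T"
  obtains \<nu> where "\<nu> \<in> invariant_measures T"
    "\<And>(h :: 'a \<Rightarrow> real) c. continuous_on UNIV h \<Longrightarrow> (\<And>m. h ((T ^^ m) y) \<le> c) \<Longrightarrow> integral\<^sup>L \<nu> h \<le> c"
proof -
  obtain \<nu> r where \<nu>: "\<nu> \<in> borel_probs" and r: "strict_mono (r :: nat \<Rightarrow> nat)"
    and lim: "\<And>h. continuous_on UNIV h \<Longrightarrow>
       (\<lambda>n. (\<Sum>i\<le>r n. h ((T ^^ i) y)) / real (Suc (r n))) \<longlonglongrightarrow> integral\<^sup>L \<nu> (h :: 'a \<Rightarrow> real)"
    using ex_weak_limit_of_averages[OF cpt, of "\<lambda>i. (T ^^ i) y"] by blast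
  have T: "T \<in> borel_measurable borel" by (rule borel_measurable_continuous_onI[OF cont])
  have T\<nu>: "T \<in> measurable \<nu> borel"
    using T measurable_cong_sets[OF borel_probs_sets[OF \<nu>] refl] by blast
  have "distr \<nu> borel T = \<nu>"
  proof (rule borel_probs_eqI)
    show "distr \<nu> borel T \<in> borel_probs"
      using prob_space.prob_space_distr[OF borel_probs_prob_space[OF \<nu>] T\<nu>] by (simp add: borel_probs_def)
    fix f :: "'a \<Rightarrow> real" assume f: "continuous_on UNIV f" "\<And>x. \<bar>f x\<bar> \<le> 1"
    define s where "s n = (\<Sum>i\<le>r n. f ((T ^^ i) y))" for n
    have fT: "continuous_on UNIV (\<lambda>x. f (T x))"
      using continuous_on_compose2[OF f(1) cont] by simp
    \<comment> \<open>Shifting the orbit by one step telescopes: only the two end terms change, and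
      they disappear after division by \<open>Suc (r n)\<close>.\<close>
    have sT: "(\<Sum>i\<le>r n. f (T ((T ^^ i) y))) = s n + (f ((T ^^ Suc (r n)) y) - f y)" for n
    proof -
      have "(\<Sum>i\<le>r n. f (T ((T ^^ i) y))) = (\<Sum>i\<le>r n. f ((T ^^ Suc i) y))" by simp
      also have "\<dots> = (\<Sum>i\<le>Suc (r n). f ((T ^^ i) y)) - f y"
        by (subst sum.atMost_Suc_shift) simp
      finally show ?thesis by (simp add: s_def)
    qed
    have "(\<lambda>n. (f ((T ^^ Suc (r n)) y) - f y) / real (Suc (r n))) \<longlonglongrightarrow> 0"
    proof (rule Lim_null_comparison)
      have "\<bar>f u - f v\<bar> \<le> 2" for u v using f(2)[of u] f(2)[of v] by linarith
      then show "\<forall>\<^sub>F n in sequentially. norm ((f ((T ^^ Suc (r n)) y) - f y) / real (Suc (r n))) \<le> 2 * inverse (real (Suc (r n)))"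
        by (intro always_eventually allI) (simp add: divide_inverse mult_right_mono abs_mult del: funpow.simps of_nat_Suc)
      show "(\<lambda>n. 2 * inverse (real (Suc (r n)))) \<longlonglongrightarrow> 0"
        using tendsto_mult_left[OF LIMSEQ_subseq_LIMSEQ[OF LIMSEQ_inverse_real_of_nat r], of 2]
        by (simp add: o_def)
    qed
    from tendsto_add[OF lim[OF f(1)] this]
    have "(\<lambda>n. (\<Sum>i\<le>r n. f (T ((T ^^ i) y))) / real (Suc (r n))) \<longlonglongrightarrow> integral\<^sup>L \<nu> f"
      unfolding sT by (simp only: s_def add_divide_distrib add_0_right)
    with lim[OF fT] have "(\<integral>x. f (T x) \<partial>\<nu>) = integral\<^sup>L \<nu> f" by (rule LIMSEQ_unique)
    then show "integral\<^sup>L (distr \<nu> borel T) f = integral\<^sup>L \<nu> f"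
      by (subst integral_distr[OF T\<nu> borel_measurable_continuous_onI[OF f(1)]])
  qed (rule \<nu>)
  then have "\<nu> \<in> invariant_measures T" by (rule distr_eq_imp_invariant[OF \<nu> T])
  moreover have "integral\<^sup>L \<nu> h \<le> c"
    if h: "continuous_on UNIV h" "\<And>m. h ((T ^^ m) y) \<le> c" for h :: "'a \<Rightarrow> real" and c
  proof (rule LIMSEQ_le_const2[OF lim[OF h(1)]], intro exI allI impI)
    fix n
    have "(\<Sum>i\<le>r n. h ((T ^^ i) y)) \<le> real (card {..r n}) * c"
      by (rule sum_bounded_above) (rule h(2))
    then show "(\<Sum>i\<le>r n. h ((T ^^ i) y)) / real (Suc (r n)) \<le> c"
      by (simp add: divide_le_eq mult.commute)
  qed
  ultimately show ?thesis using that by blast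
qed

section \<open>Pseudo-orbits with prescribed averages\<close>

text \<open>The list is one period and does not repeat its base point \<open>u\<close>; appending
  \<open>u\<close> makes the closing jump subject to the same bound. Loops at a common
  \<open>u\<close> can thus be concatenated.\<close>

definition pseudo_loop :: "('a::metric_space \<Rightarrow> 'a) \<Rightarrow> real \<Rightarrow> 'a \<Rightarrow> 'a list \<Rightarrow> bool" where
  "pseudo_loop T \<delta> u ws \<longleftrightarrow> ws \<noteq> [] \<and> hd ws = u \<and> successively (\<lambda>a b. dist (T a) b < \<delta>) (ws @ [u])"

lemma pseudo_loop_append:
  "pseudo_loop T \<delta> u ws \<Longrightarrow> pseudo_loop T \<delta> u ws' \<Longrightarrow> pseudo_loop T \<delta> u (ws @ ws')"
  by (auto simp: pseudo_loop_def successively_append_iff)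

lemma pseudo_loop_concat:
  "bs \<noteq> [] \<Longrightarrow> (\<And>b. b \<in> set bs \<Longrightarrow> pseudo_loop T \<delta> u b) \<Longrightarrow> pseudo_loop T \<delta> u (concat bs)"
proof (induction bs rule: list_nonempty_induct)
  case (cons b bs)
  then show ?case by (auto intro: pseudo_loop_append)
qed simp

definition orbit_list :: "('a \<Rightarrow> 'a) \<Rightarrow> nat \<Rightarrow> 'a \<Rightarrow> 'a list" where
  "orbit_list T n x = map (\<lambda>i. (T ^^ i) x) [0..<n]"

lemma length_orbit_list [simp]: "length (orbit_list T n x) = n"
  by (simp add: orbit_list_def)

lemma orbit_list_ends:
  assumes "n > 0"
  shows "orbit_list T n x \<noteq> []" "hd (orbit_list T n x) = x" "T (last (orbit_list T n x)) = (T ^^ n) x"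
proof -
  show "orbit_list T n x \<noteq> []" "hd (orbit_list T n x) = x"
    using assms by (simp_all add: orbit_list_def hd_map)
  obtain m where "n = Suc m" using assms gr0_implies_Suc by blast
  then show "T (last (orbit_list T n x)) = (T ^^ n) x"
    by (simp add: orbit_list_def)
qed

lemma successively_orbit_list:
  "\<delta> > 0 \<Longrightarrow> successively (\<lambda>a b. dist (T a) b < \<delta>) (orbit_list T n x)"
  by (auto simp: successively_conv_nth orbit_list_def)

lemma sum_list_orbit_list: "sum_list (map f (orbit_list T n x)) = birkhoff_sum T n f x"
  by (simp add: orbit_list_def birkhoff_sum_def o_def interv_sum_list_conv_sum_set_nat atLeast0LessThan)

text \<open>Cover the space by finitely many balls of radius \<open>\<delta>/2\<close>. Transitivity
  joins any two of them by an orbit segment, and \<open>M\<close> is the largest of these finitely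
  many lengths, hence independent of \<open>a\<close> and \<open>b\<close>.\<close>

lemma transitive_bounded_chains:
  fixes T :: "'a::metric_space \<Rightarrow> 'a"
  assumes "compact (UNIV :: 'a set)" "transitive_map T" "\<delta> > 0"
  obtains M where
    "\<And>a b. \<exists>zs. length zs \<le> M \<and> successively (\<lambda>a b. dist (T a) b < \<delta>) (a # zs @ [b])"
proof -
  have "\<exists>F. finite F \<and> (UNIV :: 'a set) \<subseteq> (\<Union>x\<in>F. ball x (\<delta>/2))"
  proof (rule compactE_image[OF assms(1), of UNIV "\<lambda>x. ball x (\<delta>/2)"])
    show "(UNIV :: 'a set) \<subseteq> (\<Union>x\<in>UNIV. ball x (\<delta>/2))"
    proof
      fix x :: 'a
      have "x \<in> ball x (\<delta>/2)" using assms(3) by simp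
      then show "x \<in> (\<Union>x\<in>UNIV. ball x (\<delta>/2))" by blast
    qed
  qed blast+
  then obtain F where F: "finite F" "(UNIV :: 'a set) \<subseteq> (\<Union>x\<in>F. ball x (\<delta>/2))" by blast
  have "\<exists>n>0. (T ^^ n) ` ball c (\<delta>/2) \<inter> ball c' (\<delta>/2) \<noteq> {}" for c c'
    using assms(2,3) unfolding transitive_map_def by auto
  then obtain N where N: "\<And>c c'. N c c' > 0" "\<And>c c'. (T ^^ N c c') ` ball c (\<delta>/2) \<inter> ball c' (\<delta>/2) \<noteq> {}"
    by metis
  define M where "M = Max ((\<lambda>(c, c'). N c c') ` (F \<times> F))"
  have "\<exists>zs. length zs \<le> M \<and> successively (\<lambda>a b. dist (T a) b < \<delta>) (a # zs @ [b])" for a b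
  proof -
    \<comment> \<open>The first ball is taken around \<open>T a\<close>, not \<open>a\<close>: the
      chain jumps from \<open>T a\<close> to \<open>p\<close>, follows the orbit of
      \<open>p\<close>, and jumps to \<open>b\<close> at its end.\<close>
    obtain c where c: "c \<in> F" "dist c (T a) < \<delta>/2" using F(2) UNIV_I[of "T a"] by fastforce
    obtain c' where c': "c' \<in> F" "dist c' b < \<delta>/2" using F(2) UNIV_I[of b] by fastforce
    obtain p where p: "dist c p < \<delta>/2" "dist c' ((T ^^ N c c') p) < \<delta>/2"
      using N(2)[of c c'] by auto
    define zs where "zs = orbit_list T (N c c') p"
    have "N c c' \<le> M"
      unfolding M_def using c(1) c'(1) F(1) by (intro Max_ge) auto
    moreover have "dist (T a) p < \<delta>" "dist ((T ^^ N c c') p) b < \<delta>"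
      using dist_triangle3[of "T a" p c] dist_triangle3[of "(T ^^ N c c') p" b c'] p c(2) c'(2) by linarith+
    ultimately show ?thesis
      using orbit_list_ends[OF N(1), of T c c' p] successively_orbit_list[OF assms(3), of T "N c c'" p]
      by (intro exI[of _ zs]) (auto simp: zs_def successively_Cons successively_append_iff)
  qed
  then show ?thesis using that by blast
qed

text \<open>The loop runs from \<open>u\<close> to \<open>x\<close>, along the orbit segment, and
  back to \<open>u\<close>. Besides the segment it has at most \<open>2 * M + 1\<close> points, a
  number that does not grow with \<open>n\<close>.\<close>

lemma ex_pseudo_loop_through_orbit:
  fixes T :: "'a::metric_space \<Rightarrow> 'a"
  assumes chains: "\<And>a b. \<exists>zs. length zs \<le> M \<and> successively (\<lambda>a b. dist (T a) b < \<delta>) (a # zs @ [b])"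
    and "\<delta> > 0" "n > 0"
  obtains ws where "pseudo_loop T \<delta> u ws" "n \<le> length ws"
    "\<And>f B. (\<And>x. \<bar>f x\<bar> \<le> B) \<Longrightarrow> \<bar>sum_list (map f ws) - birkhoff_sum T n f x\<bar> \<le> real (2 * M + 1) * B"
proof -
  define os where "os = orbit_list T n x"
  obtain zs where zs: "length zs \<le> M" "successively (\<lambda>a b. dist (T a) b < \<delta>) (u # zs @ [x])"
    using chains by blast
  obtain zs' where zs': "length zs' \<le> M" "successively (\<lambda>a b. dist (T a) b < \<delta>) (last os # zs' @ [u])"
    using chains by blast
  have os: "os \<noteq> []" "hd os = x" "successively (\<lambda>a b. dist (T a) b < \<delta>) os"
    using orbit_list_ends[OF assms(3), of T x] successively_orbit_list[OF assms(2), of T n x]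
    by (simp_all add: os_def)
  define ws where "ws = (u # zs) @ os @ zs'"
  show ?thesis
  proof
    show "pseudo_loop T \<delta> u ws"
      using zs(2) zs'(2) os
      by (auto simp: pseudo_loop_def ws_def successively_append_iff successively_Cons hd_append split: if_splits)
    show "n \<le> length ws" by (simp add: ws_def os_def)
    fix f :: "'a \<Rightarrow> real" and B :: real assume B: "\<And>x. \<bar>f x\<bar> \<le> B"
    have bound: "\<bar>sum_list (map f xs)\<bar> \<le> real (length xs) * B" for xs
    proof (induction xs)
      case (Cons y xs)
      then show ?case using B[of y] by (simp add: algebra_simps)
    qed simp
    have "0 \<le> B" using B[of u] by linarith
    have "sum_list (map f ws) - birkhoff_sum T n f x = sum_list (map f ((u # zs) @ zs'))"
      by (simp add: ws_def os_def sum_list_orbit_list)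
    also have "\<bar>\<dots>\<bar> \<le> real (length ((u # zs) @ zs')) * B" by (rule bound)
    also have "\<dots> \<le> real (2 * M + 1) * B"
      using zs(1) zs'(1) \<open>0 \<le> B\<close> by (intro mult_right_mono of_nat_mono) auto
    finally show "\<bar>sum_list (map f ws) - birkhoff_sum T n f x\<bar> \<le> real (2 * M + 1) * B" .
  qed
qed

text \<open>The points are chosen greedily: as the \<open>v j\<close> have mean zero, some point does not increase the
  sum of squares by more than \<open>K\<close>. This replaces the law of large numbers.\<close>

lemma ex_points_with_small_sums:
  fixes v :: "'j \<Rightarrow> 'a \<Rightarrow> real"
  assumes "prob_space \<mu>" "finite J"
    and int: "\<And>j. j \<in> J \<Longrightarrow> integrable \<mu> (v j)" "\<And>j. j \<in> J \<Longrightarrow> integral\<^sup>L \<mu> (v j) = 0"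
    and K: "\<And>x. (\<Sum>j\<in>J. (v j x)\<^sup>2) \<le> K"
  shows "\<exists>xs. length xs = r \<and> (\<Sum>j\<in>J. (sum_list (map (v j) xs))\<^sup>2) \<le> real r * K"
proof (induction r)
  case 0
  then show ?case by simp
next
  case (Suc r)
  interpret prob_space \<mu> by fact
  obtain xs where xs: "length xs = r" "(\<Sum>j\<in>J. (sum_list (map (v j) xs))\<^sup>2) \<le> real r * K"
    using Suc by blast
  define S where "S j = sum_list (map (v j) xs)" for j
  \<comment> \<open>This is half the cross term in the new sum of squares. Its integral is 0, so it
    cannot be positive everywhere.\<close>
  have "\<exists>x. (\<Sum>j\<in>J. S j * v j x) \<le> 0"
  proof (rule ccontr)
    assume "\<not> ?thesis"
    then have "AE x in \<mu>. (\<Sum>j\<in>J. S j * v j x) > 0" by (simp add: not_le)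
    moreover have "integrable \<mu> (\<lambda>x. \<Sum>j\<in>J. S j * v j x)" using int(1) by auto
    ultimately have "(\<integral>x. (\<Sum>j\<in>J. S j * v j x) \<partial>\<mu>) > 0" by (intro expectation_greater)
    moreover have "(\<integral>x. (\<Sum>j\<in>J. S j * v j x) \<partial>\<mu>) = (\<Sum>j\<in>J. S j * integral\<^sup>L \<mu> (v j))"
      using int(1) by (subst Bochner_Integration.integral_sum) auto
    ultimately show False using int(2) by simp
  qed
  then obtain x where x: "(\<Sum>j\<in>J. S j * v j x) \<le> 0" by blast
  have "(\<Sum>j\<in>J. (sum_list (map (v j) (x # xs)))\<^sup>2) = (\<Sum>j\<in>J. (v j x)\<^sup>2 + 2 * (S j * v j x) + (S j)\<^sup>2)"
    by (intro sum.cong refl) (simp add: S_def power2_sum algebra_simps)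
  also have "\<dots> = (\<Sum>j\<in>J. (v j x)\<^sup>2) + 2 * (\<Sum>j\<in>J. S j * v j x) + (\<Sum>j\<in>J. (S j)\<^sup>2)"
    by (simp add: sum.distrib sum_distrib_left)
  also have "\<dots> \<le> K + real r * K" using K[of x] x xs(2) by (simp add: S_def)
  finally show ?case using xs(1) by (intro exI[of _ "x # xs"]) (simp add: algebra_simps)
qed

text \<open>The loop is a concatenation of \<open>r\<close> loops, each following an orbit segment
  of length \<open>n\<close>. Large \<open>n\<close> makes the connecting pieces negligible; large
  \<open>r\<close> makes the deviation of the chosen Birkhoff sums, of order the square root of
  \<open>r\<close>, negligible. Each error gets half of \<open>t\<close>.\<close>

lemma ex_generic_pseudo_loop:
  fixes T :: "'a::metric_space \<Rightarrow> 'a"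
  assumes cpt: "compact (UNIV :: 'a set)" and cont: "continuous_on UNIV T" and trans: "transitive_map T"
    and \<mu>: "\<mu> \<in> invariant_measures T"
    and G: "finite G" "\<And>g. g \<in> G \<Longrightarrow> continuous_on UNIV (g :: 'a \<Rightarrow> real)"
    and "\<delta> > 0" "t > 0"
  obtains ws where "pseudo_loop T \<delta> u ws"
    "\<And>g. g \<in> G \<Longrightarrow> \<bar>sum_list (map g ws) - real (length ws) * integral\<^sup>L \<mu> g\<bar> \<le> real (length ws) * t"
proof -
  note \<mu>' = invariant_measures_borel_probs[OF \<mu>]
  interpret prob_space \<mu> using borel_probs_prob_space[OF \<mu>'] .
  obtain M where M: "\<And>a b. \<exists>zs. length zs \<le> M \<and> successively (\<lambda>a b. dist (T a) b < \<delta>) (a # zs @ [b])"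
    using transitive_bounded_chains[OF cpt trans \<open>\<delta> > 0\<close>] by blast
  \<comment> \<open>Centring at the \<open>\<mu>\<close>-mean gives the Birkhoff sums integral 0, as
    the greedy choice requires.\<close>
  define h :: "('a \<Rightarrow> real) \<Rightarrow> 'a \<Rightarrow> real" where "h g x = g x - integral\<^sup>L \<mu> g" for g x
  have h: "continuous_on UNIV (h g)" "integral\<^sup>L \<mu> (h g) = 0" if "g \<in> G" for g
  proof -
    show "continuous_on UNIV (h g)"
      unfolding h_def by (intro continuous_intros G(2) that)
    show "integral\<^sup>L \<mu> (h g) = 0"
      unfolding h_def using borel_probs_integrable_continuous[OF cpt \<mu>' G(2)[OF that]]
      by (simp add: prob_space)
  qed
  have "\<exists>B>0. \<forall>g\<in>G. \<forall>x. \<bar>h g x\<bar> \<le> B"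
  proof -
    have "\<exists>B>0. \<forall>x. \<bar>h g x\<bar> \<le> B" if "g \<in> G" for g
      by (rule compact_imp_continuous_bounded[OF cpt h(1)[OF that]]) blast
    then have "\<forall>g\<in>G. \<exists>B>0. \<forall>x. \<bar>h g x\<bar> \<le> B" by blast
    from bchoice[OF this] obtain b where b: "\<And>g. g \<in> G \<Longrightarrow> 0 < b g \<and> (\<forall>x. \<bar>h g x\<bar> \<le> b g)" by blast
    have le: "b g \<le> sum b G" if "g \<in> G" for g
      using member_le_sum[of g G b] that b G(1) by (simp add: less_imp_le)
    have "\<bar>h g x\<bar> \<le> 1 + sum b G" if "g \<in> G" for g x
      using b[OF that] le[OF that] by (auto intro: order_trans)
    moreover have "0 < 1 + sum b G" using sum_nonneg[of G b] b by (simp add: less_imp_le add_pos_nonneg)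
    ultimately show ?thesis by blast
  qed
  then obtain B where B: "B > 0" "\<And>g x. g \<in> G \<Longrightarrow> \<bar>h g x\<bar> \<le> B" by blast
  \<comment> \<open>\<open>D\<close> bounds the contribution of the connecting pieces to one block,
    for all \<open>g\<close> in \<open>G\<close> at once; \<open>n\<close> is chosen so that this is
    at most \<open>n * t / 2\<close>.\<close>
  define D where "D = real (2 * M + 1) * B"
  obtain n where n: "2 * D / t < real n" using reals_Archimedean2 by blast
  have "D > 0" using B(1) by (simp add: D_def)
  have "n > 0" using n \<open>D > 0\<close> \<open>t > 0\<close> by (cases n) (simp_all add: divide_less_0_iff)
  have Dn: "D \<le> real n * t / 2" using n \<open>t > 0\<close> by (simp add: field_simps)
  have "\<exists>ws. pseudo_loop T \<delta> u ws \<and> n \<le> length ws \<and>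
      (\<forall>g\<in>G. \<bar>sum_list (map (h g) ws) - birkhoff_sum T n (h g) x\<bar> \<le> D)" for x
  proof (rule ex_pseudo_loop_through_orbit[OF M \<open>\<delta> > 0\<close> \<open>n > 0\<close>, of u x])
    fix ws assume ws: "pseudo_loop T \<delta> u ws" "n \<le> length ws"
      "\<And>f B. (\<And>x. \<bar>f x\<bar> \<le> B) \<Longrightarrow> \<bar>sum_list (map f ws) - birkhoff_sum T n f x\<bar> \<le> real (2 * M + 1) * B"
    have "\<bar>sum_list (map (h g) ws) - birkhoff_sum T n (h g) x\<bar> \<le> D" if "g \<in> G" for g
      unfolding D_def using B(2)[OF that] by (rule ws(3))
    then show ?thesis using ws(1,2) by blast
  qed
  then have "\<forall>x. \<exists>ws. pseudo_loop T \<delta> u ws \<and> n \<le> length ws \<and>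
      (\<forall>g\<in>G. \<bar>sum_list (map (h g) ws) - birkhoff_sum T n (h g) x\<bar> \<le> D)" by blast
  from choice[OF this] obtain W where W: "\<And>x. pseudo_loop T \<delta> u (W x)" "\<And>x. n \<le> length (W x)"
    "\<And>x g. g \<in> G \<Longrightarrow> \<bar>sum_list (map (h g) (W x)) - birkhoff_sum T n (h g) x\<bar> \<le> D"
    by blast
  \<comment> \<open>\<open>K\<close> bounds the sum over \<open>G\<close> of the squared Birkhoff
    sums of length \<open>n\<close>; \<open>r\<close> is chosen so that \<open>r * K\<close> is at
    most the square of \<open>r * n * t / 2\<close>.\<close>
  define K where "K = real (card G) * (real n * B)\<^sup>2"
  obtain r where r: "K / (real n * t / 2)\<^sup>2 < real r" using reals_Archimedean2 by blast
  have "K \<ge> 0" by (simp add: K_def)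
  have nt: "real n * t / 2 > 0" using \<open>n > 0\<close> \<open>t > 0\<close> by simp
  have "0 \<le> K / (real n * t / 2)\<^sup>2" using \<open>K \<ge> 0\<close> by simp
  then have "r > 0" using r by linarith
  have Kr: "K \<le> real r * (real n * t / 2)\<^sup>2"
    using r pos_divide_less_eq[OF zero_less_power[OF nt, of 2]] by (meson less_imp_le)
  have sum_bound: "\<bar>birkhoff_sum T n (h g) x\<bar> \<le> real n * B" if "g \<in> G" for g x
    unfolding birkhoff_sum_def using sum_norm_bound[of "{..<n}" "\<lambda>i. h g ((T ^^ i) x)" B] B(2)[OF that] by simp
  have "\<exists>xs. length xs = r \<and> (\<Sum>g\<in>G. (sum_list (map (birkhoff_sum T n (h g)) xs))\<^sup>2) \<le> real r * K"
  proof (rule ex_points_with_small_sums[OF _ G(1)])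
    show "prob_space \<mu>" by (rule borel_probs_prob_space[OF \<mu>'])
    show "integrable \<mu> (birkhoff_sum T n (h g))" if "g \<in> G" for g
      by (intro borel_probs_integrable_continuous[OF cpt \<mu>'] continuous_on_birkhoff_sum cont h that)
    show "integral\<^sup>L \<mu> (birkhoff_sum T n (h g)) = 0" if "g \<in> G" for g
      using invariant_integral_birkhoff_sum[OF cpt cont \<mu> h(1)[OF that]] h(2)[OF that] by simp
    show "(\<Sum>g\<in>G. (birkhoff_sum T n (h g) x)\<^sup>2) \<le> K" for x
      unfolding K_def
    proof (rule sum_bounded_above)
      fix g assume "g \<in> G"
      from power_mono[OF sum_bound[OF this, of x], of 2]
      show "(birkhoff_sum T n (h g) x)\<^sup>2 \<le> (real n * B)\<^sup>2" by simp
    qed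
  qed
  then obtain xs where xs: "length xs = r"
    "(\<Sum>g\<in>G. (sum_list (map (birkhoff_sum T n (h g)) xs))\<^sup>2) \<le> real r * K" by blast
  define ws where "ws = concat (map W xs)"
  have len: "real (length ys) * real n \<le> real (length (concat (map W ys)))" for ys
  proof (induction ys)
    case (Cons y ys)
    then show ?case using W(2)[of y] by (simp add: algebra_simps)
  qed simp
  have diff: "\<bar>sum_list (map (h g) (concat (map W ys))) - sum_list (map (birkhoff_sum T n (h g)) ys)\<bar>
      \<le> real (length ys) * D" if "g \<in> G" for g ys
  proof (induction ys)
    case (Cons y ys)
    then show ?case using W(3)[OF that, of y] by (simp add: algebra_simps)
  qed simp
  have centred: "sum_list (map (h g) zs) = sum_list (map g zs) - real (length zs) * integral\<^sup>L \<mu> g" for g zs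
    by (induction zs) (simp_all add: h_def algebra_simps)
  show ?thesis
  proof
    show "pseudo_loop T \<delta> u ws"
      unfolding ws_def using xs(1) \<open>r > 0\<close> W(1) by (intro pseudo_loop_concat) auto
    fix g assume g: "g \<in> G"
    define s where "s = sum_list (map (birkhoff_sum T n (h g)) xs)"
    have "s\<^sup>2 \<le> (\<Sum>g\<in>G. (sum_list (map (birkhoff_sum T n (h g)) xs))\<^sup>2)"
      unfolding s_def using g G(1)
      by (intro member_le_sum[of g G "\<lambda>g. (sum_list (map (birkhoff_sum T n (h g)) xs))\<^sup>2"]) auto
    also have "\<dots> \<le> real r * (real r * (real n * t / 2)\<^sup>2)"
      using xs(2) mult_left_mono[OF Kr, of "real r"] by linarith
    also have "\<dots> = (real r * (real n * t / 2))\<^sup>2" by (simp add: power2_eq_square algebra_simps)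
    finally have "\<bar>s\<bar> \<le> real r * (real n * t / 2)"
      using nt by (simp add: abs_le_square_iff[symmetric])
    moreover have "\<bar>sum_list (map (h g) ws) - s\<bar> \<le> real r * (real n * t / 2)"
      using diff[OF g, of xs] mult_left_mono[OF Dn, of "real r"] xs(1) by (simp add: ws_def s_def)
    ultimately have "\<bar>sum_list (map (h g) ws)\<bar> \<le> 2 * (real r * (real n * t / 2))" by linarith
    also have "\<dots> = real r * real n * t" by simp
    \<comment> \<open>Each of the \<open>r\<close> blocks has at least \<open>n\<close> points, so
      the absolute error is small relative to the actual length.\<close>
    also have "\<dots> \<le> real (length ws) * t"
      using len[of xs] xs(1) \<open>t > 0\<close> by (intro mult_right_mono) (simp_all add: ws_def)
    finally show "\<bar>sum_list (map g ws) - real (length ws) * integral\<^sup>L \<mu> g\<bar> \<le> real (length ws) * t"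
      by (simp add: centred)
  qed
qed

section \<open>Density of measures with nearly constant averages\<close>

text \<open>A shift by one only moves one summand from the front to the back. This makes a sum over
  a full period independent of where it starts.\<close>

lemma sum_cyclic_shift:
  fixes f :: "nat \<Rightarrow> 'b::ab_group_add"
  shows "(\<Sum>i<P. f ((m + i) mod P)) = (\<Sum>i<P. f i)"
proof (cases "P = 0")
  case False
  show ?thesis
  proof (induction m)
    case 0
    show ?case by (rule sum.cong) auto
  next
    case (Suc m)
    obtain Q where Q: "P = Suc Q" using False not0_implies_Suc by blast
    have "(\<Sum>i<P. f ((Suc m + i) mod P)) = (\<Sum>i<Q. f ((m + Suc i) mod P)) + f (m mod P)"
      using mod_add_self2[of m P] by (simp add: Q)
    also have "\<dots> = (\<Sum>i<P. f ((m + i) mod P))"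
      unfolding Q sum.lessThan_Suc_shift by (simp add: add.commute)
    finally show ?case using Suc by simp
  qed
qed simp

lemma pseudo_loop_nth_0: "pseudo_loop T \<delta> u ws \<Longrightarrow> ws ! 0 = u"
  unfolding pseudo_loop_def using hd_conv_nth by metis

lemma pseudo_loop_imp_pseudo_orbit:
  assumes "pseudo_loop T \<delta> u ws"
  shows "pseudo_orbit T \<delta> (\<lambda>i. ws ! (i mod length ws))"
  unfolding pseudo_orbit_def
proof
  fix n
  define P where "P = length ws"
  have "P > 0" using assms by (simp add: P_def pseudo_loop_def)
  have step: "dist (T ((ws @ [u]) ! i)) ((ws @ [u]) ! Suc i) < \<delta>" if "i < P" for i
    using assms that by (auto simp: pseudo_loop_def successively_conv_nth P_def)
  have i: "n mod P < P" using \<open>P > 0\<close> by simp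
  have "dist (T (ws ! (n mod P))) (ws ! (Suc n mod P)) < \<delta>"
  proof (cases "Suc (n mod P) < P")
    case True
    then show ?thesis using step[OF i] i by (simp add: mod_Suc nth_append P_def)
  next
    \<comment> \<open>At the end of a period the index wraps to 0, and the step is the closing jump
      to \<open>u\<close>.\<close>
    case False
    then have "Suc (n mod P) = P" using i by simp
    moreover have "ws ! 0 = u" using assms by (rule pseudo_loop_nth_0)
    ultimately show ?thesis using step[OF i] i by (simp add: mod_Suc nth_append P_def)
  qed
  then show "dist (T (ws ! (n mod length ws))) (ws ! (Suc n mod length ws)) < \<delta>" by (simp add: P_def)
qed

lemma funpow_funpow: "(f ^^ i) ((f ^^ m) y) = (f ^^ (m + i)) y"
  by (subst add.commute) (simp only: funpow_add o_apply)

text \<open>Every window of \<open>length ws\<close> consecutive times meets each entry of the loop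
  once. The bound therefore holds from every point of the orbit of \<open>y\<close>, which lets it
  pass to measures carried by that orbit.\<close>

lemma traced_loop_birkhoff_sum:
  assumes "traces T \<epsilon> y (\<lambda>i. ws ! (i mod length ws))"
    and "\<And>a b. dist a b < \<epsilon> \<Longrightarrow> \<bar>g a - g b\<bar> \<le> t"
  shows "\<bar>birkhoff_sum T (length ws) g ((T ^^ m) y) - sum_list (map g ws)\<bar> \<le> real (length ws) * t"
proof -
  define P where "P = length ws"
  have "sum_list (map g ws) = (\<Sum>i<P. g (ws ! ((m + i) mod P)))"
    using sum_cyclic_shift[of "\<lambda>i. g (ws ! i)" m P]
    by (simp add: sum_list_sum_nth P_def atLeast0LessThan)
  then have "birkhoff_sum T P g ((T ^^ m) y) - sum_list (map g ws)
      = (\<Sum>i<P. g ((T ^^ (m + i)) y) - g (ws ! ((m + i) mod P)))"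
    by (simp add: birkhoff_sum_def sum_subtractf funpow_funpow)
  also have "\<bar>\<dots>\<bar> \<le> (\<Sum>i<P. \<bar>g ((T ^^ (m + i)) y) - g (ws ! ((m + i) mod P))\<bar>)" by (rule sum_abs)
  also have "\<dots> \<le> real P * t"
  proof -
    have "(\<Sum>i<P. \<bar>g ((T ^^ (m + i)) y) - g (ws ! ((m + i) mod P))\<bar>) \<le> real (card {..<P}) * t"
      using assms by (intro sum_bounded_above) (auto simp: traces_def P_def)
    then show ?thesis by simp
  qed
  finally show ?thesis by (simp add: P_def)
qed

text \<open>The mass of a ball need not be weak* continuous in the measure, but the integral of this
  function is on a compact space, and it is positive exactly when the ball has positive
  mass.\<close>

definition bump :: "'a::metric_space \<Rightarrow> real \<Rightarrow> 'a \<Rightarrow> real" where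
  "bump u \<rho> x = max 0 (\<rho> - dist x u)"

lemma continuous_on_bump: "continuous_on UNIV (bump u \<rho>)"
  unfolding bump_def by (intro continuous_intros)

lemma bump_nonneg: "0 \<le> bump u \<rho> x"
  by (simp add: bump_def)

lemma bump_pos_iff: "0 < bump u \<rho> x \<longleftrightarrow> dist x u < \<rho>"
  by (auto simp: bump_def)

text \<open>For invariant \<open>\<mu>\<close>, continuous \<open>g\<close> on a compact space and
  \<open>N > 0\<close>, the Birkhoff average has the same mean as \<open>g\<close>, so this is its
  variance. For \<open>N = 0\<close> the first term is 0 and the value is never positive, hence the
  condition \<open>N > 0\<close> wherever smallness is demanded.\<close>

definition average_variance :: "('a \<Rightarrow> 'a) \<Rightarrow> nat \<Rightarrow> ('a \<Rightarrow> real) \<Rightarrow> 'a measure \<Rightarrow> real" where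
  "average_variance T N g \<mu> = (\<integral>x. (birkhoff_sum T N g x / N)\<^sup>2 \<partial>\<mu>) - (integral\<^sup>L \<mu> g)\<^sup>2"

lemma finite_uniform_modulus:
  fixes G :: "('a::metric_space \<Rightarrow> real) set"
  assumes "compact (UNIV :: 'a set)" "finite G" "\<And>g. g \<in> G \<Longrightarrow> continuous_on UNIV g" "t > 0"
  shows "\<exists>e>0. \<forall>g\<in>G. \<forall>a b. dist a b < e \<longrightarrow> \<bar>g a - g b\<bar> \<le> t"
  using assms(2,3)
proof (induction G rule: finite_induct)
  case empty
  show ?case by (intro exI[of _ 1]) simp
next
  case (insert g G)
  obtain e where e: "e > 0" "\<And>g a b. g \<in> G \<Longrightarrow> dist a b < e \<Longrightarrow> \<bar>g a - g b\<bar> \<le> t"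
    using insert by auto
  have "uniformly_continuous_on UNIV g"
    using compact_uniformly_continuous assms(1) insert.prems by blast
  then obtain d where d: "d > 0" "\<And>a b. dist a b < d \<Longrightarrow> dist (g a) (g b) < t"
    unfolding uniformly_continuous_on_def using \<open>t > 0\<close> by (metis UNIV_I)
  have "\<bar>g a - g b\<bar> \<le> t" if "dist a b < d" for a b
    using d(2)[OF that] by (simp add: dist_real_def)
  then show ?case using d(1) e by (intro exI[of _ "min d e"]) auto
qed

text \<open>Along the orbit of a shadowing point, the average of each \<open>g\<close> over one
  period is uniformly within \<open>t\<close> of its \<open>\<mu>\<close>-integral. For a measure
  carried by the orbit this controls both the mean and the second moment. The loop passes through
  \<open>u\<close>, so each period also visits the ball around \<open>u\<close>.\<close>

lemma approx_by_nearly_constant_averages: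
  fixes T :: "'a::metric_space \<Rightarrow> 'a"
  assumes cpt: "compact (UNIV :: 'a set)" and cont: "continuous_on UNIV T" and trans: "transitive_map T"
    and shadow: "shadowing_property T"
    and \<mu>: "\<mu> \<in> invariant_measures T"
    and G: "finite G" "\<And>g. g \<in> G \<Longrightarrow> continuous_on UNIV (g :: 'a \<Rightarrow> real)"
    and "e > 0" "\<rho> > 0"
  obtains \<nu> N where "\<nu> \<in> invariant_measures T" "N > 0"
    "\<And>g. g \<in> G \<Longrightarrow> \<bar>integral\<^sup>L \<nu> g - integral\<^sup>L \<mu> g\<bar> \<le> e"
    "\<And>g. g \<in> G \<Longrightarrow> average_variance T N g \<nu> \<le> e"
    "integral\<^sup>L \<nu> (bump u \<rho>) > 0"
proof -
  \<comment> \<open>The cap at 1 gives \<open>t^2 \<le> t \<le> e\<close>, which the variance bound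
    uses.\<close>
  define t where "t = min 1 e"
  have t: "0 < t" "t \<le> 1" "t \<le> e" using \<open>e > 0\<close> by (auto simp: t_def)
  obtain \<epsilon>1 where \<epsilon>1: "\<epsilon>1 > 0" "\<And>g a b. g \<in> G \<Longrightarrow> dist a b < \<epsilon>1 \<Longrightarrow> \<bar>g a - g b\<bar> \<le> t/2"
    using finite_uniform_modulus[OF cpt G, of "t/2"] t(1) by auto
  \<comment> \<open>Tracing within \<open>\<rho>/2\<close> leaves the bump a height of at least
    \<open>\<rho>/2\<close> at each visit near \<open>u\<close>.\<close>
  define \<epsilon> where "\<epsilon> = min \<epsilon>1 (\<rho>/2)"
  have "\<epsilon> > 0" using \<epsilon>1(1) \<open>\<rho> > 0\<close> by (simp add: \<epsilon>_def)
  then obtain \<delta> where \<delta>: "\<delta> > 0" "\<And>x. pseudo_orbit T \<delta> x \<Longrightarrow> \<exists>y. traces T \<epsilon> y x"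
    using shadow unfolding shadowing_property_def by blast
  obtain ws where ws: "pseudo_loop T \<delta> u ws"
    "\<And>g. g \<in> G \<Longrightarrow> \<bar>sum_list (map g ws) - real (length ws) * integral\<^sup>L \<mu> g\<bar> \<le> real (length ws) * (t/2)"
    using ex_generic_pseudo_loop[OF cpt cont trans \<mu> G \<delta>(1), of "t/2" u] t(1) by auto
  obtain y where y: "traces T \<epsilon> y (\<lambda>i. ws ! (i mod length ws))"
    using \<delta>(2)[OF pseudo_loop_imp_pseudo_orbit[OF ws(1)]] by blast
  define P where "P = length ws"
  have "P > 0" using ws(1) by (simp add: P_def pseudo_loop_def)
  have "ws ! 0 = u" using ws(1) by (rule pseudo_loop_nth_0)
  obtain \<nu> where \<nu>: "\<nu> \<in> invariant_measures T"
    and bd: "\<And>(h :: 'a \<Rightarrow> real) c. continuous_on UNIV h \<Longrightarrow> (\<And>m. h ((T ^^ m) y) \<le> c) \<Longrightarrow> integral\<^sup>L \<nu> h \<le> c"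
    using ex_invariant_measure_on_orbit[OF cpt cont] by blast
  note \<nu>' = invariant_measures_borel_probs[OF \<nu>]
  interpret N: prob_space \<nu> using borel_probs_prob_space[OF \<nu>'] .
  note integrable = borel_probs_integrable_continuous[OF cpt \<nu>']
  define A where "A g x = birkhoff_sum T P g x / P" for g x
  have contA: "continuous_on UNIV (A g)" if "continuous_on UNIV g" for g
    unfolding A_def by (intro continuous_intros continuous_on_birkhoff_sum cont that) (use \<open>P > 0\<close> in simp)
  have intA: "integral\<^sup>L \<nu> (A g) = integral\<^sup>L \<nu> g" if "continuous_on UNIV g" for g
    unfolding A_def using invariant_integral_birkhoff_sum[OF cpt cont \<nu> that] \<open>P > 0\<close> by simp
  have close: "\<bar>A g ((T ^^ m) y) - integral\<^sup>L \<mu> g\<bar> \<le> t" if "g \<in> G" for g m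
  proof -
    have "\<bar>birkhoff_sum T P g ((T ^^ m) y) - sum_list (map g ws)\<bar> \<le> real P * (t/2)"
      unfolding P_def using \<epsilon>1(2)[OF that] by (intro traced_loop_birkhoff_sum[OF y]) (simp add: \<epsilon>_def)
    then have "\<bar>birkhoff_sum T P g ((T ^^ m) y) - real P * integral\<^sup>L \<mu> g\<bar> \<le> real P * t"
      using ws(2)[OF that] unfolding P_def by linarith
    moreover have "birkhoff_sum T P g ((T ^^ m) y) - real P * integral\<^sup>L \<mu> g
        = real P * (A g ((T ^^ m) y) - integral\<^sup>L \<mu> g)"
      using \<open>P > 0\<close> by (simp add: A_def algebra_simps)
    ultimately show ?thesis using \<open>P > 0\<close> by (simp add: abs_mult)
  qed
  show ?thesis
  proof
    show "\<nu> \<in> invariant_measures T" "P > 0" by fact+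
    fix g assume g: "g \<in> G"
    define c where "c = integral\<^sup>L \<mu> g"
    have "integral\<^sup>L \<nu> (A g) \<le> c + t"
      using close[OF g] by (intro bd contA G g) (auto simp: c_def abs_le_iff algebra_simps)
    \<comment> \<open>The orbit lemma gives upper bounds only, so the lower bound is obtained from
      the negated average.\<close>
    moreover have "integral\<^sup>L \<nu> (\<lambda>x. - A g x) \<le> t - c"
      using close[OF g] by (intro bd continuous_intros contA G g) (auto simp: c_def abs_le_iff algebra_simps)
    ultimately show "\<bar>integral\<^sup>L \<nu> g - integral\<^sup>L \<mu> g\<bar> \<le> e"
      using intA[OF G(2)[OF g]] t(3) by (simp add: c_def abs_le_iff)
    have "integral\<^sup>L \<nu> (\<lambda>x. (A g x - c)\<^sup>2) \<le> t\<^sup>2"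
    proof (intro bd continuous_intros contA G g)
      fix m
      show "(A g ((T ^^ m) y) - c)\<^sup>2 \<le> t\<^sup>2"
        using power_mono[OF close[OF g, of m] abs_ge_zero, of 2] by (simp add: c_def)
    qed
    moreover have "integral\<^sup>L \<nu> (\<lambda>x. (A g x - c)\<^sup>2)
        = integral\<^sup>L \<nu> (\<lambda>x. (A g x)\<^sup>2) - 2 * c * integral\<^sup>L \<nu> g + c\<^sup>2"
    proof -
      have "integrable \<nu> (\<lambda>x. (A g x)\<^sup>2)" "integrable \<nu> (A g)"
        by (intro integrable continuous_intros contA G g)+
      then show ?thesis
        using intA[OF G(2)[OF g]] by (simp add: power2_diff N.prob_space mult.commute mult.left_commute)
    qed
    \<comment> \<open>The second moment about \<open>c\<close> is the variance plus the squared
      distance from \<open>c\<close> to the mean.\<close>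
    ultimately have "average_variance T P g \<nu> + (integral\<^sup>L \<nu> g - c)\<^sup>2 \<le> t\<^sup>2"
      by (simp add: average_variance_def A_def[symmetric] power2_diff algebra_simps)
    then have "average_variance T P g \<nu> \<le> t\<^sup>2"
      using zero_le_power2[of "integral\<^sup>L \<nu> g - c"] by linarith
    also have "t\<^sup>2 \<le> e" using t power_decreasing[of 1 2 t] by simp
    finally show "average_variance T P g \<nu> \<le> e" .
  next
    have low: "\<rho> / (2 * P) \<le> A (bump u \<rho>) ((T ^^ m) y)" for m
    proof -
      \<comment> \<open>\<open>i\<close> is the waiting time until the loop is next at
        \<open>u\<close>; the outer \<open>mod P\<close> turns a wait of \<open>P\<close> into 0
        when it is there already.\<close>
      obtain i where i: "i < P" "(m + i) mod P = 0"
      proof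
        show "(P - m mod P) mod P < P" using \<open>P > 0\<close> by simp
        have "(m + (P - m mod P) mod P) mod P = (m mod P + (P - m mod P)) mod P"
          by (simp add: mod_simps)
        then show "(m + (P - m mod P) mod P) mod P = 0" using \<open>P > 0\<close> by (simp add: less_imp_le)
      qed
      have "dist ((T ^^ (m + i)) y) u < \<rho>/2"
        using y i(2) \<open>ws ! 0 = u\<close> unfolding traces_def P_def \<epsilon>_def by (metis min_less_iff_conj)
      then have "\<rho>/2 \<le> bump u \<rho> ((T ^^ i) ((T ^^ m) y))"
        unfolding bump_def funpow_funpow by linarith
      also have "\<dots> \<le> birkhoff_sum T P (bump u \<rho>) ((T ^^ m) y)"
        unfolding birkhoff_sum_def using i(1) bump_nonneg by (intro member_le_sum) auto
      finally show ?thesis using \<open>P > 0\<close> by (simp add: A_def field_simps)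
    qed
    have "integral\<^sup>L \<nu> (\<lambda>x. - A (bump u \<rho>) x) \<le> - (\<rho> / (2 * P))"
      using low by (intro bd continuous_intros contA continuous_on_bump) simp
    then have "\<rho> / (2 * P) \<le> integral\<^sup>L \<nu> (bump u \<rho>)" using intA[OF continuous_on_bump] by simp
    moreover have "\<rho> / (2 * P) > 0" using \<open>\<rho> > 0\<close> \<open>P > 0\<close> by simp
    ultimately show "integral\<^sup>L \<nu> (bump u \<rho>) > 0" by linarith
  qed
qed

section \<open>Residual sets and ergodicity\<close>

text \<open>The complement of a dense open set is closed with empty interior, and these complements
  cover the complement of \<open>R\<close>.\<close>

lemma residual_inI:
  assumes "countable \<G>" "\<And>G. G \<in> \<G> \<Longrightarrow> openin Y G" "\<And>G. G \<in> \<G> \<Longrightarrow> Y closure_of G = topspace Y"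
    and "R \<subseteq> topspace Y" "topspace Y \<inter> \<Inter>\<G> \<subseteq> R"
  shows "residual_in Y R"
  unfolding residual_in_def first_category_in_def
\<comment> \<open>First category is defined by equality with a countable union, so each complement
  is cut down to the part outside \<open>R\<close>.\<close>
proof (intro conjI exI[of _ "(\<lambda>G. topspace Y - R - G) ` \<G>"] ballI)
  fix N assume "N \<in> (\<lambda>G. topspace Y - R - G) ` \<G>"
  then obtain G where G: "G \<in> \<G>" "N = topspace Y - R - G" by blast
  have "Y closure_of N \<subseteq> topspace Y - G"
    using G assms(2) by (intro closure_of_minimal) auto
  then have "Y interior_of (Y closure_of N) \<subseteq> Y interior_of (topspace Y - G)" by (rule interior_of_mono)
  also have "\<dots> = {}" using assms(3) G(1) by (simp add: interior_of_complement)
  finally show "nowhere_dense_in Y N" using G(2) by (auto simp: nowhere_dense_in_def)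
qed (use assms in auto)

section \<open>Open and dense conditions in the weak* topology\<close>

lemma continuous_map_weak_star_integral:
  fixes f :: "'a::metric_space \<Rightarrow> real"
  assumes "continuous_on UNIV f"
  shows "continuous_map weak_star_topology euclideanreal (\<lambda>\<mu>. integral\<^sup>L \<mu> f)"
  unfolding continuous_map_def topspace_weak_star_topology
proof (intro conjI allI impI)
  fix U :: "real set" assume "openin euclideanreal U"
  then show "openin weak_star_topology {\<mu> \<in> borel_probs. integral\<^sup>L \<mu> f \<in> U}"
    unfolding weak_star_topology_def using assms by (intro topology_generated_by_Basis) auto
qed auto

text \<open>Induction over the generation of open sets: a subbasic set needs one function, an
  intersection takes the union of the two families and the smaller tolerance, and a union inherits
  the data of the member containing \<open>\<mu>\<close>.\<close>

lemma weak_star_neighbourhood: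
  fixes V :: "'a::metric_space measure set"
  assumes "openin weak_star_topology V" "\<mu> \<in> V"
  shows "\<exists>G e. finite G \<and> (\<forall>g\<in>G. continuous_on UNIV (g :: 'a \<Rightarrow> real)) \<and> e > 0 \<and>
    (\<forall>\<nu>\<in>borel_probs. (\<forall>g\<in>G. \<bar>integral\<^sup>L \<nu> g - integral\<^sup>L \<mu> g\<bar> < e) \<longrightarrow> \<nu> \<in> V)"
proof -
  have "generate_topology_on {{\<mu> \<in> borel_probs. integral\<^sup>L \<mu> f \<in> U} | (f :: 'a \<Rightarrow> real) U.
      continuous_on UNIV f \<and> open U} V"
    using assms(1) by (simp add: weak_star_topology_def openin_topology_generated_by_iff)
  then show ?thesis
    using assms(2)
  proof induction
    case Empty
    then show ?case by simp
  next
    case (Int A B)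
    obtain G e where G: "finite G" "\<forall>g\<in>G. continuous_on UNIV (g :: 'a \<Rightarrow> real)" "e > 0"
      "\<forall>\<nu>\<in>borel_probs. (\<forall>g\<in>G. \<bar>integral\<^sup>L \<nu> g - integral\<^sup>L \<mu> g\<bar> < e) \<longrightarrow> \<nu> \<in> A"
      using Int by blast
    obtain G' e' where G': "finite G'" "\<forall>g\<in>G'. continuous_on UNIV (g :: 'a \<Rightarrow> real)" "e' > 0"
      "\<forall>\<nu>\<in>borel_probs. (\<forall>g\<in>G'. \<bar>integral\<^sup>L \<nu> g - integral\<^sup>L \<mu> g\<bar> < e') \<longrightarrow> \<nu> \<in> B"
      using Int by blast
    show ?case
      by (rule exI[of _ "G \<union> G'"], rule exI[of _ "min e e'"]) (use G G' in auto)
  next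
    case (UN K)
    then obtain k where k: "k \<in> K" "\<mu> \<in> k" by blast
    obtain G e where G: "finite G" "\<forall>g\<in>G. continuous_on UNIV (g :: 'a \<Rightarrow> real)" "e > 0"
      "\<forall>\<nu>\<in>borel_probs. (\<forall>g\<in>G. \<bar>integral\<^sup>L \<nu> g - integral\<^sup>L \<mu> g\<bar> < e) \<longrightarrow> \<nu> \<in> k"
      using UN.IH[OF k] by blast
    show ?case
      by (rule exI[of _ G], rule exI[of _ e]) (use G k in blast)
  next
    case (Basis s)
    then obtain f :: "'a \<Rightarrow> real" and U where f: "continuous_on UNIV f" "open U"
      "s = {\<mu> \<in> borel_probs. integral\<^sup>L \<mu> f \<in> U}" by blast
    obtain e where "e > 0" "\<And>z. dist z (integral\<^sup>L \<mu> f) < e \<Longrightarrow> z \<in> U"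
      using f(2,3) Basis(2) unfolding open_dist by blast
    then show ?case
      using f by (intro exI[of _ "{f}"] exI[of _ e]) (auto simp: dist_real_def)
  qed
qed

lemma openin_average_variance:
  fixes T :: "'a::metric_space \<Rightarrow> 'a" and f :: "'a \<Rightarrow> real"
  assumes "continuous_on UNIV T" "continuous_on UNIV f"
  shows "openin (invariant_measure_space T) {\<mu> \<in> invariant_measures T. average_variance T N f \<mu> < d}"
proof -
  have "continuous_on UNIV (\<lambda>x. (birkhoff_sum T N f x / N)\<^sup>2)"
    \<comment> \<open>Multiplication by the inverse is continuous without a side condition, so
      \<open>N = 0\<close> needs no separate case.\<close>
    unfolding divide_inverse by (intro continuous_intros continuous_on_birkhoff_sum assms)
  then have "continuous_map (invariant_measure_space T) euclideanreal (average_variance T N f)"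
    unfolding average_variance_def invariant_measure_space_def
    by (intro continuous_map_diff continuous_map_real_pow continuous_map_from_subtopology
        continuous_map_weak_star_integral assms)
  from openin_continuous_map_preimage[OF this, of "{..<d}"] show ?thesis
    by (simp add: topspace_invariant_measure_space)
qed

lemma openin_integral_pos:
  fixes T :: "'a::metric_space \<Rightarrow> 'a" and f :: "'a \<Rightarrow> real"
  assumes "continuous_on UNIV f"
  shows "openin (invariant_measure_space T) {\<mu> \<in> invariant_measures T. 0 < integral\<^sup>L \<mu> f}"
proof -
  have "continuous_map (invariant_measure_space T) euclideanreal (\<lambda>\<mu>. integral\<^sup>L \<mu> f)"
    unfolding invariant_measure_space_def
    by (intro continuous_map_from_subtopology continuous_map_weak_star_integral assms)
  from openin_continuous_map_preimage[OF this, of "{0<..}"] show ?thesis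
    by (simp add: topspace_invariant_measure_space)
qed

text \<open>Adding \<open>f\<close> to the finite family that describes a neighbourhood lets a
  single approximating measure lie in the neighbourhood and satisfy both conditions.\<close>

lemma dense_nearly_constant_averages:
  fixes T :: "'a::metric_space \<Rightarrow> 'a" and f :: "'a \<Rightarrow> real"
  assumes "compact (UNIV :: 'a set)" "continuous_on UNIV T" "transitive_map T" "shadowing_property T"
    and "continuous_on UNIV f" "d > 0" "\<rho> > 0"
  shows "invariant_measure_space T closure_of
      {\<mu> \<in> invariant_measures T. (\<exists>N>0. average_variance T N f \<mu> < d) \<and> 0 < integral\<^sup>L \<mu> (bump u \<rho>)}
    = topspace (invariant_measure_space T)"
  unfolding dense_intersects_open
proof (intro allI impI)
  fix W assume W: "openin (invariant_measure_space T) W \<and> W \<noteq> {}"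
  then obtain V where V: "openin weak_star_topology V" "W = V \<inter> invariant_measures T"
    unfolding invariant_measure_space_def openin_subtopology by blast
  obtain \<mu> where \<mu>: "\<mu> \<in> V" "\<mu> \<in> invariant_measures T" using W V(2) by blast
  obtain G e where G: "finite G" "\<forall>g\<in>G. continuous_on UNIV (g :: 'a \<Rightarrow> real)" "e > 0"
    and GV: "\<forall>\<nu>\<in>borel_probs. (\<forall>g\<in>G. \<bar>integral\<^sup>L \<nu> g - integral\<^sup>L \<mu> g\<bar> < e) \<longrightarrow> \<nu> \<in> V"
    using weak_star_neighbourhood[OF V(1) \<mu>(1)] by blast
  \<comment> \<open>Halving \<open>min e d\<close> turns the non-strict bounds of the approximation
    into strict ones.\<close>
  have "finite (insert f G)" "\<And>g. g \<in> insert f G \<Longrightarrow> continuous_on UNIV g" "min e d / 2 > 0"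
    using G assms(5,6) by auto
  from approx_by_nearly_constant_averages[OF assms(1-4) \<mu>(2) this \<open>\<rho> > 0\<close>, of u]
  obtain \<nu> N where \<nu>: "\<nu> \<in> invariant_measures T" "N > 0"
    "\<And>g. g \<in> insert f G \<Longrightarrow> \<bar>integral\<^sup>L \<nu> g - integral\<^sup>L \<mu> g\<bar> \<le> min e d / 2"
    "\<And>g. g \<in> insert f G \<Longrightarrow> average_variance T N g \<nu> \<le> min e d / 2"
    "integral\<^sup>L \<nu> (bump u \<rho>) > 0"
    by blast
  have "\<bar>integral\<^sup>L \<nu> g - integral\<^sup>L \<mu> g\<bar> < e" if "g \<in> G" for g
    using \<nu>(3)[of g] that \<open>e > 0\<close> \<open>d > 0\<close> by simp
  then have "\<nu> \<in> V" using GV invariant_measures_borel_probs[OF \<nu>(1)] by blast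
  moreover have "average_variance T N f \<nu> < d"
    using \<nu>(4)[of f] \<open>e > 0\<close> \<open>d > 0\<close> by simp
  ultimately show "{\<mu> \<in> invariant_measures T. (\<exists>N>0. average_variance T N f \<mu> < d) \<and>
      0 < integral\<^sup>L \<mu> (bump u \<rho>)} \<inter> W \<noteq> {}"
    using \<nu>(1,2,5) V(2) by blast
qed

section \<open>Test functions dense in the mean\<close>

text \<open>Terms naming a family of continuous functions; being a datatype makes the family countable.\<close>

datatype test_term = Base nat nat | Compl test_term | Join test_term test_term

instance test_term :: countable
  by countable_datatype

text \<open>As \<open>n\<close> grows, \<open>Base k n\<close> increases to the indicator of the
  \<open>k\<close>-th ball; \<open>Compl\<close> and \<open>Join\<close> act on indicators as
  complement and union.\<close>

primrec test_fun :: "(nat \<Rightarrow> 'a::metric_space) \<Rightarrow> (nat \<Rightarrow> real) \<Rightarrow> test_term \<Rightarrow> 'a \<Rightarrow> real" where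
  "test_fun c r (Base k n) = (\<lambda>x. min 1 (real n * bump (c k) (r k) x))"
| "test_fun c r (Compl s) = (\<lambda>x. 1 - test_fun c r s x)"
| "test_fun c r (Join s s') = (\<lambda>x. max (test_fun c r s x) (test_fun c r s' x))"

lemma continuous_on_test_fun: "continuous_on UNIV (test_fun c r s)"
  by (induction s) (auto intro!: continuous_intros continuous_on_bump)

lemma test_fun_bounds: "0 \<le> test_fun c r s x \<and> test_fun c r s x \<le> 1"
  by (induction s) (auto simp: bump_nonneg le_max_iff_disj)

text \<open>A ball of radius below \<open>e/2\<close> containing \<open>x\<close> lies in
  \<open>ball x e\<close>. Replacing unsuitable balls by the empty set keeps the union indexed by
  all naturals, as the approximation of Borel sets needs.\<close>

lemma fine_balls_open_Union:
  assumes "fine_balls c r" "open U"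
  shows "U = (\<Union>k. if ball (c k) (r k) \<subseteq> U then ball (c k) (r k) else {})"
proof (intro equalityI subsetI)
  fix x assume "x \<in> U"
  then obtain e where e: "e > 0" "ball x e \<subseteq> U" using assms(2) open_contains_ball by blast
  obtain k where k: "dist x (c k) < r k" "r k < e/2"
    using assms(1) e(1) unfolding fine_balls_def by (meson half_gt_zero)
  have "ball (c k) (r k) \<subseteq> ball x e"
  proof
    fix y assume "y \<in> ball (c k) (r k)"
    then show "y \<in> ball x e" using k dist_triangle[of x y "c k"] by simp
  qed
  then show "x \<in> (\<Union>k. if ball (c k) (r k) \<subseteq> U then ball (c k) (r k) else {})"
    using e(2) k(1) by (intro UN_I[of k]) (auto simp: dist_commute)
qed (auto split: if_splits)

text \<open>The sets whose indicators are approximable in the mean contain the balls of the family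
  and are closed under complements and countable unions, so they include all open sets and then all
  Borel sets.\<close>

lemma borel_set_approx:
  fixes A :: "'a::metric_space set"
  assumes fine: "fine_balls c r" and \<mu>: "\<mu> \<in> borel_probs" and A: "A \<in> sets borel" and "e > 0"
  shows "\<exists>s. (\<integral>x. \<bar>test_fun c r s x - indicator A x\<bar> \<partial>\<mu>) < e"
proof -
  interpret prob_space \<mu> using borel_probs_prob_space[OF \<mu>] .
  note [measurable_cong] = borel_probs_sets[OF \<mu>]
  have [measurable]: "test_fun c r s \<in> borel_measurable borel" for s
    by (rule borel_measurable_continuous_onI[OF continuous_on_test_fun])
  have integrable: "integrable \<mu> (\<lambda>x. \<bar>test_fun c r s x - indicator A x\<bar>)"
    if [measurable]: "A \<in> sets borel" for s A
  proof (rule borel_probs_integrable[OF \<mu>, of _ 1])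
    show "\<bar>\<bar>test_fun c r s x - indicator A x\<bar>\<bar> \<le> 1" for x
      using test_fun_bounds[of c r s x] by (auto simp: indicator_def)
  qed measurable
  define apx where "apx A \<longleftrightarrow> A \<in> sets borel \<and>
    (\<forall>e>0. \<exists>s. (\<integral>x. \<bar>test_fun c r s x - indicator A x\<bar> \<partial>\<mu>) < e)" for A
  have empty: "apx {}"
    unfolding apx_def
  \<comment> \<open>\<open>Base 0 0\<close> is the zero function, because its factor
    \<open>n\<close> is 0.\<close>
  proof (intro conjI allI impI exI[of _ "Base 0 0"])
    fix e :: real assume "e > 0"
    then show "(\<integral>x. \<bar>test_fun c r (Base 0 0) x - indicator {} x\<bar> \<partial>\<mu>) < e" by simp
  qed simp
  have compl: "apx (- A)" if apx_A: "apx A" for A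
    unfolding apx_def
  proof (intro conjI allI impI)
    show "- A \<in> sets borel" using that unfolding apx_def by (blast intro: borel_comp)
    fix e :: real assume "e > 0"
    then obtain s where "(\<integral>x. \<bar>test_fun c r s x - indicator A x\<bar> \<partial>\<mu>) < e"
      using apx_A unfolding apx_def by blast
    moreover have "\<bar>test_fun c r (Compl s) x - indicator (- A) x\<bar> = \<bar>test_fun c r s x - indicator A x\<bar>" for x
      by (auto simp: indicator_def abs_minus_commute)
    ultimately show "\<exists>s. (\<integral>x. \<bar>test_fun c r s x - indicator (- A) x\<bar> \<partial>\<mu>) < e"
      by (intro exI[of _ "Compl s"]) simp
  qed
  have union: "apx (A \<union> B)" if apx_AB: "apx A" "apx B" for A B
    unfolding apx_def
  proof (intro conjI allI impI)
    have [measurable]: "A \<in> sets borel" "B \<in> sets borel" using that by (simp_all add: apx_def)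
    then show "A \<union> B \<in> sets borel" by simp
    fix e :: real assume "e > 0"
    then obtain s s' where s: "(\<integral>x. \<bar>test_fun c r s x - indicator A x\<bar> \<partial>\<mu>) < e/2"
      "(\<integral>x. \<bar>test_fun c r s' x - indicator B x\<bar> \<partial>\<mu>) < e/2"
      using apx_AB unfolding apx_def by (meson half_gt_zero)
    have "(\<integral>x. \<bar>test_fun c r (Join s s') x - indicator (A \<union> B) x\<bar> \<partial>\<mu>)
      \<le> (\<integral>x. \<bar>test_fun c r s x - indicator A x\<bar> + \<bar>test_fun c r s' x - indicator B x\<bar> \<partial>\<mu>)"
    proof (intro integral_mono integrable Bochner_Integration.integrable_add)
      show "\<bar>test_fun c r (Join s s') x - indicator (A \<union> B) x\<bar>
        \<le> \<bar>test_fun c r s x - indicator A x\<bar> + \<bar>test_fun c r s' x - indicator B x\<bar>" for x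
        using test_fun_bounds[of c r s x] test_fun_bounds[of c r s' x]
        by (auto simp: indicator_def max_def)
    qed (use that in \<open>simp_all add: apx_def\<close>)
    also have "\<dots> < e"
      using s by (subst Bochner_Integration.integral_add) (simp_all add: integrable)
    finally show "\<exists>s. (\<integral>x. \<bar>test_fun c r s x - indicator (A \<union> B) x\<bar> \<partial>\<mu>) < e" by blast
  qed
  have Union: "apx (\<Union>i. A i)" if "\<And>i. apx (A i)" for A :: "nat \<Rightarrow> 'a set"
    unfolding apx_def
  proof (intro conjI allI impI)
    have [measurable]: "A i \<in> sets borel" for i using that by (simp add: apx_def)
    then show "(\<Union>i. A i) \<in> sets borel" by auto
    fix e :: real assume "e > 0"
    \<comment> \<open>Half of \<open>e\<close> pays for replacing the union by a finite one, by
      continuity from below; the other half pays for approximating the finite union.\<close>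
    define B where "B n = (\<Union>i<n. A i)" for n
    have [measurable]: "B n \<in> sets borel" for n by (auto simp: B_def)
    have "apx (B n)" for n
      by (induction n) (auto simp: B_def lessThan_Suc empty intro!: union that)
    have "(\<lambda>n. measure \<mu> (B n)) \<longlonglongrightarrow> measure \<mu> (\<Union>n. B n)"
    proof (rule finite_Lim_measure_incseq)
      show "range B \<subseteq> sets \<mu>" by (auto simp: borel_probs_sets[OF \<mu>])
      show "incseq B" unfolding incseq_def B_def by (intro allI impI UN_mono) auto
    qed
    moreover have UB: "(\<Union>n. B n) = (\<Union>i. A i)" by (auto simp: B_def)
    ultimately obtain n where n: "dist (measure \<mu> (B n)) (measure \<mu> (\<Union>i. A i)) < e/2"
      using \<open>e > 0\<close> unfolding tendsto_iff by (metis (no_types, lifting) eventually_sequentially half_gt_zero order_refl)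
    obtain s where s: "(\<integral>x. \<bar>test_fun c r s x - indicator (B n) x\<bar> \<partial>\<mu>) < e/2"
      using \<open>apx (B n)\<close> \<open>e > 0\<close> unfolding apx_def by (meson half_gt_zero)
    have sub: "B n \<subseteq> (\<Union>i. A i)" using UB by blast
    have int: "integrable \<mu> (indicator S :: 'a \<Rightarrow> real)" if "S \<in> sets borel" for S
      using that by (simp add: borel_probs_sets[OF \<mu>] emeasure_eq_measure)
    have "(\<integral>x. \<bar>test_fun c r s x - indicator (\<Union>i. A i) x\<bar> \<partial>\<mu>)
      \<le> (\<integral>x. \<bar>test_fun c r s x - indicator (B n) x\<bar> + (indicator (\<Union>i. A i) x - indicator (B n) x) \<partial>\<mu>)"
    proof (intro integral_mono integrable Bochner_Integration.integrable_add Bochner_Integration.integrable_diff int)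
      show "\<bar>test_fun c r s x - indicator (\<Union>i. A i) x\<bar>
        \<le> \<bar>test_fun c r s x - indicator (B n) x\<bar> + (indicator (\<Union>i. A i) x - indicator (B n) x)" for x
        using sub by (auto simp: indicator_def)
    qed auto
    also have "\<dots> = (\<integral>x. \<bar>test_fun c r s x - indicator (B n) x\<bar> \<partial>\<mu>) + (measure \<mu> (\<Union>i. A i) - measure \<mu> (B n))"
    proof -
      have U: "(\<Union>i. A i) \<in> sets borel" by auto
      show ?thesis
        using integrable[of "B n" s] int[OF U] int[of "B n"] U
        by (simp add: borel_probs_sets[OF \<mu>])
    qed
    also have "\<dots> < e" using s n unfolding dist_real_def by linarith
    finally show "\<exists>s. (\<integral>x. \<bar>test_fun c r s x - indicator (\<Union>i. A i) x\<bar> \<partial>\<mu>) < e" by blast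
  qed
  have ball: "apx (ball (c k) (r k))" for k
    unfolding apx_def
  proof (intro conjI allI impI)
    show "ball (c k) (r k) \<in> sets borel" by simp
    fix e :: real assume "e > 0"
    have "(\<lambda>n. \<integral>x. \<bar>test_fun c r (Base k n) x - indicator (ball (c k) (r k)) x\<bar> \<partial>\<mu>) \<longlonglongrightarrow> (\<integral>x. 0 \<partial>\<mu>)"
    proof (rule integral_dominated_convergence[where w = "\<lambda>_. 1"])
      show "AE x in \<mu>. (\<lambda>n. \<bar>test_fun c r (Base k n) x - indicator (ball (c k) (r k)) x\<bar>) \<longlonglongrightarrow> 0"
      proof (intro always_eventually allI)
        fix x
        show "(\<lambda>n. \<bar>test_fun c r (Base k n) x - indicator (ball (c k) (r k)) x\<bar>) \<longlonglongrightarrow> 0"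
        proof (cases "dist x (c k) < r k")
          case True
          then have pos: "0 < bump (c k) (r k) x" by (simp add: bump_pos_iff)
          obtain m where m: "1 < real m * bump (c k) (r k) x" using reals_Archimedean3[OF pos] by blast
          have "\<bar>test_fun c r (Base k n) x - indicator (ball (c k) (r k)) x\<bar> = 0" if "n \<ge> m" for n
          proof -
            have "real m * bump (c k) (r k) x \<le> real n * bump (c k) (r k) x"
              using that pos by (intro mult_right_mono) auto
            then show ?thesis using m True by (simp add: dist_commute)
          qed
          then show ?thesis by (intro tendsto_eventually) (auto simp: eventually_sequentially)
        next
          case False
          then have "bump (c k) (r k) x = 0"
            using bump_pos_iff[of "c k" "r k" x] bump_nonneg[of "c k" "r k" x] by linarith
          then show ?thesis using False by (simp add: dist_commute)
        qed
      qed
      show "AE x in \<mu>. norm \<bar>test_fun c r (Base k n) x - indicator (ball (c k) (r k)) x\<bar> \<le> 1" for n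
        using test_fun_bounds[of c r "Base k n"] by (intro always_eventually allI) (auto simp: indicator_def)
      show "(\<lambda>x. \<bar>test_fun c r (Base k n) x - indicator (ball (c k) (r k)) x\<bar>) \<in> borel_measurable \<mu>" for n
        by (intro borel_measurable_integrable integrable) simp
    qed auto
    then have "(\<lambda>n. \<integral>x. \<bar>test_fun c r (Base k n) x - indicator (ball (c k) (r k)) x\<bar> \<partial>\<mu>) \<longlonglongrightarrow> 0" by simp
    from eventually_happens'[OF sequentially_bot order_tendstoD(2)[OF this \<open>e > 0\<close>]]
    show "\<exists>s. (\<integral>x. \<bar>test_fun c r s x - indicator (ball (c k) (r k)) x\<bar> \<partial>\<mu>) < e"
      by blast
  qed
  have "A \<in> sigma_sets UNIV {S. open S}" using A by (simp add: borel_def)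
  then have "apx A"
  proof induction
    case (Basic U)
    have "apx (\<Union>k. if ball (c k) (r k) \<subseteq> U then ball (c k) (r k) else {})"
      by (rule Union) (simp add: ball empty)
    then show ?case using fine_balls_open_Union[OF fine, of U] Basic by simp
  next
    case Empty
    show ?case by (rule empty)
  next
    case (Compl a)
    then show ?case using compl by (simp add: Compl_eq_Diff_UNIV)
  next
    case (Union a)
    then show ?case using \<open>\<And>A. (\<And>i. apx (A i)) \<Longrightarrow> apx (\<Union>i. A i)\<close> by blast
  qed
  then show ?thesis using \<open>e > 0\<close> by (simp add: apx_def)
qed

section \<open>Criteria for full support and for ergodicity\<close>

text \<open>A nonempty open null set would contain a ball of the family, whose bump function would
  then vanish almost everywhere.\<close>

lemma full_support_criterion:
  fixes \<mu> :: "'a::metric_space measure"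
  assumes fine: "fine_balls c r" and \<mu>: "\<mu> \<in> borel_probs"
    and pos: "\<And>k. 0 < integral\<^sup>L \<mu> (bump (c k) (r k))"
  shows "measure_support \<mu> = UNIV"
proof -
  interpret prob_space \<mu> using borel_probs_prob_space[OF \<mu>] .
  have "measure \<mu> U > 0" if "open U" "x \<in> U" for U x
  proof (rule ccontr)
    assume "\<not> measure \<mu> U > 0"
    then have "measure \<mu> U = 0" using measure_nonneg[of \<mu> U] by linarith
    then have "U \<in> null_sets \<mu>"
      using \<open>open U\<close> by (simp add: null_sets_def emeasure_eq_measure borel_probs_sets[OF \<mu>])
    then have AE: "AE z in \<mu>. z \<notin> U" by (rule AE_not_in)
    obtain k where k: "ball (c k) (r k) \<subseteq> U"
      using fine_balls_open_Union[OF fine \<open>open U\<close>] \<open>x \<in> U\<close> by (auto split: if_splits)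
    have "AE z in \<mu>. bump (c k) (r k) z = 0"
      using AE
    proof eventually_elim
      case (elim z)
      then have "\<not> 0 < bump (c k) (r k) z" using k by (auto simp: bump_pos_iff dist_commute)
      then show ?case using bump_nonneg[of "c k" "r k" z] by linarith
    qed
    then have "integral\<^sup>L \<mu> (bump (c k) (r k)) = 0" by (rule integral_eq_zero_AE)
    then show False using pos[of k] by simp
  qed
  then show ?thesis by (auto simp: measure_support_def)
qed

text \<open>For an invariant set \<open>A\<close> of measure \<open>a\<close>, a test function
  \<open>f\<close> close to its indicator has Birkhoff averages just as close. The second moment of
  an average is then near \<open>a\<close>, while small variance puts it, up to a small error, below
  the squared mean, which is near \<open>a^2\<close>. So \<open>a\<close> is 0 or 1.\<close>

lemma ergodic_criterion:
  fixes T :: "'a::metric_space \<Rightarrow> 'a"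
  assumes cpt: "compact (UNIV :: 'a set)" and cont: "continuous_on UNIV T"
    and fine: "fine_balls c r" and \<mu>: "\<mu> \<in> invariant_measures T"
    and var: "\<And>s d. d > 0 \<Longrightarrow> \<exists>N>0. average_variance T N (test_fun c r s) \<mu> < d"
  shows "ergodic_measure T \<mu>"
proof -
  note \<mu>' = invariant_measures_borel_probs[OF \<mu>]
  interpret prob_space \<mu> using borel_probs_prob_space[OF \<mu>'] .
  have "measure \<mu> A = 0 \<or> measure \<mu> A = 1" if A: "A \<in> sets borel" "T -` A = A" for A
  proof -
    define a where "a = measure \<mu> A"
    have a01: "0 \<le> a" "a \<le> 1" by (simp_all add: a_def)
    have inv: "indicator A ((T ^^ i) x) = (indicator A x :: real)" for i x
    proof -
      have "T z \<in> A \<longleftrightarrow> z \<in> A" for z using A(2) by blast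
      then have "(T ^^ i) x \<in> A \<longleftrightarrow> x \<in> A" by (induction i) auto
      then show ?thesis by (simp add: indicator_def)
    qed
    have [measurable]: "A \<in> sets borel" by fact
    have int_A: "integrable \<mu> (indicator A :: 'a \<Rightarrow> real)" "integral\<^sup>L \<mu> (indicator A) = a"
      using A(1) by (simp_all add: borel_probs_sets[OF \<mu>'] emeasure_eq_measure a_def)
    have eps: "a - a\<^sup>2 \<le> e" if "e > 0" for e
    proof -
      \<comment> \<open>The fifths add up at the end: \<open>2 * D\<close> from the second moment,
        \<open>2 * D\<close> from the squared mean, and one from the variance.\<close>
      obtain s where s: "(\<integral>x. \<bar>test_fun c r s x - indicator A x\<bar> \<partial>\<mu>) < e/5"
        using borel_set_approx[OF fine \<mu>' A(1), of "e/5"] \<open>e > 0\<close> by auto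
      define f where "f = test_fun c r s"
      define D where "D = (\<integral>x. \<bar>f x - indicator A x\<bar> \<partial>\<mu>)"
      have f: "continuous_on UNIV f" "\<And>x. 0 \<le> f x" "\<And>x. f x \<le> 1"
        using continuous_on_test_fun test_fun_bounds[of c r s] by (simp_all add: f_def)
      have [measurable]: "f \<in> borel_measurable borel" by (rule borel_measurable_continuous_onI[OF f(1)])
      obtain N where N: "N > 0" "average_variance T N f \<mu> < e/5"
        using var[of "e/5" s] \<open>e > 0\<close> by (auto simp: f_def)
      define b where "b x = birkhoff_sum T N f x / N" for x
      have contb: "continuous_on UNIV b"
        unfolding b_def by (intro continuous_intros continuous_on_birkhoff_sum cont f) (use N(1) in simp)
      have [measurable]: "b \<in> borel_measurable borel" by (rule borel_measurable_continuous_onI[OF contb])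
      have b01: "0 \<le> b x" "b x \<le> 1" for x
      proof -
        show "0 \<le> b x" unfolding b_def birkhoff_sum_def using f(2) by (intro divide_nonneg_nonneg sum_nonneg) auto
        have "birkhoff_sum T N f x \<le> real (card {..<N}) * 1"
          unfolding birkhoff_sum_def by (rule sum_bounded_above) (rule f(3))
        then show "b x \<le> 1" using N(1) by (simp add: b_def)
      qed
      have bdd: "integrable \<mu> g" if "g \<in> borel_measurable borel" "\<And>x. \<bar>g x\<bar> \<le> 1" for g :: "'a \<Rightarrow> real"
        using borel_probs_integrable[OF \<mu>' that] .
      have ib: "integrable \<mu> (\<lambda>x. \<bar>b x - indicator A x\<bar>)"
      proof (rule bdd)
        show "\<bar>\<bar>b x - indicator A x\<bar>\<bar> \<le> 1" for x
          using b01[of x] by (auto simp: indicator_def)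
      qed measurable
      have ifi: "integrable \<mu> (\<lambda>x. \<bar>f ((T ^^ i) x) - indicator A x\<bar>)" for i
      proof (rule bdd)
        have [measurable]: "T ^^ i \<in> borel_measurable borel"
          by (rule borel_measurable_continuous_onI[OF continuous_on_funpow[OF cont]])
        show "(\<lambda>x. \<bar>f ((T ^^ i) x) - indicator A x\<bar>) \<in> borel_measurable borel" by measurable
        show "\<bar>\<bar>f ((T ^^ i) x) - indicator A x\<bar>\<bar> \<le> 1" for x
          using f(2,3)[of "(T ^^ i) x"] by (auto simp: indicator_def)
      qed
      \<comment> \<open>Invariance of \<open>A\<close> replaces its indicator at \<open>x\<close> by
        that at \<open>(T ^^ i) x\<close>; invariance of \<open>\<mu>\<close> then removes the
        shift.\<close>
      have orbit_D: "(\<integral>x. \<bar>f ((T ^^ i) x) - indicator A x\<bar> \<partial>\<mu>) = D" for i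
      proof -
        have "(\<lambda>z. \<bar>f z - indicator A z\<bar>) \<in> borel_measurable borel" by measurable
        from invariant_integral_funpow[OF \<mu> cont this, of i] show ?thesis by (simp add: inv D_def)
      qed
      have "(\<integral>x. \<bar>b x - indicator A x\<bar> \<partial>\<mu>) \<le> (\<integral>x. (\<Sum>i<N. \<bar>f ((T ^^ i) x) - indicator A x\<bar>) / N \<partial>\<mu>)"
      proof (intro integral_mono ib)
        show "integrable \<mu> (\<lambda>x. (\<Sum>i<N. \<bar>f ((T ^^ i) x) - indicator A x\<bar>) / N)"
          using ifi by auto
        fix x
        have "b x - indicator A x = (\<Sum>i<N. f ((T ^^ i) x) - indicator A x) / N"
          using N(1) by (simp add: b_def birkhoff_sum_def sum_subtractf field_simps)
        then show "\<bar>b x - indicator A x\<bar> \<le> (\<Sum>i<N. \<bar>f ((T ^^ i) x) - indicator A x\<bar>) / N"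
          using sum_abs[of "\<lambda>i. f ((T ^^ i) x) - indicator A x" "{..<N}"] N(1)
          by (simp add: abs_divide divide_right_mono)
      qed
      also have "\<dots> = (\<Sum>i<N. \<integral>x. \<bar>f ((T ^^ i) x) - indicator A x\<bar> \<partial>\<mu>) / N"
        using ifi by (simp add: Bochner_Integration.integral_sum)
      also have "\<dots> = D" using N(1) orbit_D by simp
      finally have bD: "(\<integral>x. \<bar>b x - indicator A x\<bar> \<partial>\<mu>) \<le> D" .
      have ib2: "integrable \<mu> (\<lambda>x. (b x)\<^sup>2)"
        by (rule bdd) (use b01 in \<open>auto simp: power_le_one\<close>)
      have "a = (\<integral>x. indicator A x \<partial>\<mu>)" using int_A(2) by simp
      also have "\<dots> \<le> (\<integral>x. (b x)\<^sup>2 + 2 * \<bar>b x - indicator A x\<bar> \<partial>\<mu>)"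
      proof (intro integral_mono int_A Bochner_Integration.integrable_add ib2 integrable_mult_right ib)
        fix x
        \<comment> \<open>This settles the points of \<open>A\<close>; off \<open>A\<close> the left
          side is 0 and the right side is nonnegative.\<close>
        have "1 - (b x)\<^sup>2 \<le> 2 * (1 - b x)"
          using zero_le_power2[of "b x - 1"] by (simp add: power2_diff)
        then show "indicator A x \<le> (b x)\<^sup>2 + 2 * \<bar>b x - indicator A x\<bar>"
          using b01[of x] by (auto simp: indicator_def abs_if)
      qed
      also have "\<dots> = (\<integral>x. (b x)\<^sup>2 \<partial>\<mu>) + 2 * (\<integral>x. \<bar>b x - indicator A x\<bar> \<partial>\<mu>)"
        using ib ib2 by simp
      finally have 1: "a \<le> (\<integral>x. (b x)\<^sup>2 \<partial>\<mu>) + 2 * D" using bD by linarith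
      have if': "integrable \<mu> f" by (rule bdd) (use f in auto)
      define m where "m = integral\<^sup>L \<mu> f"
      have "m - a = (\<integral>x. f x - indicator A x \<partial>\<mu>)" using if' int_A by (simp add: m_def)
      also have "\<bar>\<dots>\<bar> \<le> D" unfolding D_def by (rule integral_abs_bound)
      finally have "\<bar>m - a\<bar> \<le> D" .
      moreover have "0 \<le> m" "m \<le> 1"
        using f if' by (auto simp: m_def intro!: integral_nonneg_AE integral_le_const)
      ultimately have "m\<^sup>2 - a\<^sup>2 \<le> 2 * D"
      proof -
        have "m\<^sup>2 - a\<^sup>2 = (m - a) * (m + a)" by (simp add: power2_eq_square algebra_simps)
        also have "\<dots> \<le> \<bar>m - a\<bar> * (m + a)"
          using \<open>0 \<le> m\<close> a01 by (intro mult_right_mono) auto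
        also have "\<dots> \<le> D * 2"
          using \<open>\<bar>m - a\<bar> \<le> D\<close> \<open>0 \<le> m\<close> \<open>m \<le> 1\<close> a01 by (intro mult_mono) auto
        finally show ?thesis by simp
      qed
      moreover have "(\<integral>x. (b x)\<^sup>2 \<partial>\<mu>) - m\<^sup>2 < e/5"
        using N(2) by (simp add: average_variance_def b_def m_def)
      moreover have "D < e/5" using s by (simp add: D_def f_def)
      ultimately show ?thesis using 1 by linarith
    qed
    have "a - a\<^sup>2 \<le> 0" by (rule field_le_epsilon) (simp add: eps)
    moreover have "a\<^sup>2 \<le> a" using a01 by (simp add: power2_eq_square mult_left_le)
    ultimately have "a * (1 - a) = 0" by (simp add: power2_eq_square algebra_simps)
    then show ?thesis by (auto simp: a_def)
  qed
  then show ?thesis using \<mu> by (simp add: ergodic_measure_def)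
qed

theorem proposition3p5:
  fixes T :: "'a::metric_space \<Rightarrow> 'a"
  assumes "dynamical_system T"
    and "transitive_map T"
    and "shadowing_property T"
  shows "residual_in (invariant_measure_space T)
           {\<mu>. ergodic_measure T \<mu> \<and> measure_support \<mu> = UNIV}"
proof -
  have cpt: "compact (UNIV :: 'a set)" and cont: "continuous_on UNIV T"
    using assms(1) by (auto simp: dynamical_system_def)
  obtain c :: "nat \<Rightarrow> 'a" and r where fine: "fine_balls c r"
    using compact_imp_fine_balls[OF cpt] by blast
  \<comment> \<open>The indices are a test function, a tolerance \<open>1 / Suc n\<close> and a
    ball: a countable set, since terms are countable.\<close>
  define Gd where "Gd = (\<lambda>(s, n, k). {\<mu> \<in> invariant_measures T.
    (\<exists>N>0. average_variance T N (test_fun c r s) \<mu> < 1 / real (Suc n)) \<and> 0 < integral\<^sup>L \<mu> (bump (c k) (r k))})"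
  show ?thesis
  proof (rule residual_inI[of "range Gd"])
    show "countable (range Gd)" by simp
    fix G assume "G \<in> range Gd"
    then obtain s n k where G: "G = {\<mu> \<in> invariant_measures T.
        (\<exists>N>0. average_variance T N (test_fun c r s) \<mu> < 1 / real (Suc n)) \<and> 0 < integral\<^sup>L \<mu> (bump (c k) (r k))}"
      by (auto simp: Gd_def)
    \<comment> \<open>Variance is weak* continuous only for fixed \<open>N\<close>; the existential
      over \<open>N\<close> becomes a union of open sets.\<close>
    have "G = (\<Union>N\<in>{0<..}. {\<mu> \<in> invariant_measures T. average_variance T N (test_fun c r s) \<mu> < 1 / real (Suc n)})
        \<inter> {\<mu> \<in> invariant_measures T. 0 < integral\<^sup>L \<mu> (bump (c k) (r k))}"
      unfolding G by auto
    also have "openin (invariant_measure_space T) \<dots>"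
      by (intro openin_Int openin_Union ballI openin_integral_pos continuous_on_bump)
        (auto intro!: openin_average_variance cont continuous_on_test_fun)
    finally show "openin (invariant_measure_space T) G" .
    show "invariant_measure_space T closure_of G = topspace (invariant_measure_space T)"
      unfolding G using fine
      by (intro dense_nearly_constant_averages cpt cont assms continuous_on_test_fun) (auto simp: fine_balls_def)
  next
    show "{\<mu>. ergodic_measure T \<mu> \<and> measure_support \<mu> = UNIV} \<subseteq> topspace (invariant_measure_space T)"
      by (auto simp: topspace_invariant_measure_space ergodic_measure_def)
    show "topspace (invariant_measure_space T) \<inter> \<Inter>(range Gd)
        \<subseteq> {\<mu>. ergodic_measure T \<mu> \<and> measure_support \<mu> = UNIV}"
    proof (intro subsetI CollectI conjI)
      fix \<mu> assume "\<mu> \<in> topspace (invariant_measure_space T) \<inter> \<Inter>(range Gd)"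
      then have \<mu>: "\<mu> \<in> invariant_measures T" and "\<And>s n k. \<mu> \<in> Gd (s, n, k)"
        by (auto simp: topspace_invariant_measure_space)
      then have var: "\<exists>N>0. average_variance T N (test_fun c r s) \<mu> < 1 / real (Suc n)"
        and pos: "0 < integral\<^sup>L \<mu> (bump (c k) (r k))" for s n k
        unfolding Gd_def by auto
      show "ergodic_measure T \<mu>"
      proof (rule ergodic_criterion[OF cpt cont fine \<mu>])
        fix s and d :: real assume "d > 0"
        then obtain n where "1 / real (Suc n) < d" using nat_approx_posE by blast
        then show "\<exists>N>0. average_variance T N (test_fun c r s) \<mu> < d"
          using var[of s n] by (meson less_trans)
      qed
      show "measure_support \<mu> = UNIV"
        by (rule full_support_criterion[OF fine invariant_measures_borel_probs[OF \<mu>] pos])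
    qed
  qed
qed

end
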